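(* Let $\mathcal{H}$ be a real Hilbert space and $\beta>0$. Let $\Phi\colon\mathcal{H}\to\mathbb{R}\cup\{+\infty\}$ and $\Phi_t\colon\mathcal{H}\to\mathbb{R}\cup\{+\infty\}$ (for $t\geq 0$) be proper, convex and lower semicontinuous functions, let $D\subset\mathcal{H}$ be a nonempty closed convex set with $\overline{\operatorname{dom}\Phi}\subset D$ and $\overline{\operatorname{dom}\Phi_t}\subset D$ for all $t$, and let $B\colon D\to\mathcal{H}$ and $B_t\colon D\to\mathcal{H}$ be $\beta$-cocoercive operators. Assume that $y\in D$, $\mu\in(0,2\beta)$ and: (i) $\varepsilon\colon[0,\infty)\to(0,\infty)$ is absolutely continuous and nonincreasing with $\lim_{t\to+\infty}\varepsilon(t)=0$, $\int_0^{+\infty}\varepsilon(s)\,ds=+\infty$ and $\lim_{t\to+\infty}\dot\varepsilon(t)/\varepsilon^2(t)=0$; (ii) the map $t\mapsto\Phi_t(x)$ is measurable for all $x\in\mathcal{H}$, and there exist $\kappa\colon\mathbb{R}_+\to\mathbb{R}_+$ and positive constants $c_\Phi$ and $p$ such that $$\|\operatorname{prox}_{\mu\Phi_t}(z)-\operatorname{prox}_{\mu\Phi}(z)\|\le\kappa(t)\,(\|z\|+c_\Phi)^p\quad\text{for all }(t,z)\in\mathbb{R}_+\times\mathcal{H},$$ and $\lim_{t\to+\infty}\kappa(t)/\varepsilon(t)=0$; (iii) for every compact set $K\subset D$, $\displaystyle\lim_{t\to+\infty}\frac1{\varepsilon(t)}\sup_{x\in K}\|B_t(x)-B(x)\|=0$;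 (iv) for every $x\in D$, the map $t\mapsto\operatorname{prox}_{\mu\Phi_t}(x-\mu B_t x)$ is measurable. Let $x_0\in D$ and let $x\colon[0,+\infty)\to\mathcal{H}$ be the unique solution of $$-\dot x(t)=x(t)-\operatorname{prox}_{\mu\Phi_t}\big(x(t)-\mu B_t x(t)\big)+\varepsilon(t)\big(x(t)-y\big)\ \text{ for a.e. }t\ge0,\qquad x(0)=x_0.$$ Then $x(t)$ converges strongly to $\operatorname{proj}_{\operatorname{zer}(\partial\Phi+B)}(y)$ as $t\to+\infty$, provided that $\operatorname{zer}(\partial\Phi+B)\ne\emptyset$.
   Context: An operator $B\colon D\to\mathcal{H}$ is $\beta$-cocoercive if $\langle B(x)-B(x'),x-x'\rangle\ge\beta\|B(x)-B(x')\|^2$ for all $x,x'\in D$. The proximal operator is $\operatorname{prox}_{\mu\Phi}(x):=\operatorname{argmin}_{u\in\mathcal{H}}\{\Phi(u)+\frac{1}{2\mu}\|u-x\|^2\}$. $\operatorname{dom}\Phi=\{x:\Phi(x)<+\infty\}$, $\partial\Phi$ is the convex subdifferential, and $\operatorname{zer}(\partial\Phi+B)=\{x\in D: 0\in\partial\Phi(x)+B(x)\}$. $\operatorname{proj}_S$ is the metric projection onto a nonempty closed convex set $S$. A solution is a locally absolutely continuous function with values in $D$ satisfying the equation for a.e. $t\ge0$. The limit involving $\dot\varepsilon$, which exists only for a.e. $t$, is an essential limit. *)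

theory Defs
  imports "HOL-Analysis.Analysis"
begin

text \<open>
  Functions into the reals extended by plus infinity are modelled as \<open>ereal\<close>-valued functions;
  \<open>proper\<close> excludes the value minus infinity.
  A Hilbert space is a type of class \<open>{real_inner, complete_space}\<close>.
\<close>

definition effective_domain :: "('a \<Rightarrow> ereal) \<Rightarrow> 'a set" where
  "effective_domain \<Phi> = {x. \<Phi> x < \<infinity>}"

definition proper :: "('a \<Rightarrow> ereal) \<Rightarrow> bool" where
  "proper \<Phi> \<longleftrightarrow> (\<forall>x. \<Phi> x \<noteq> -\<infinity>) \<and> effective_domain \<Phi> \<noteq> {}"

text \<open>The products below use the \<open>ereal\<close> convention that zero times infinity is zero.\<close>

definition ereal_convex :: "('a::real_vector \<Rightarrow> ereal) \<Rightarrow> bool" where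
  "ereal_convex \<Phi> \<longleftrightarrow>
     (\<forall>x y. \<forall>u\<ge>0. \<forall>v\<ge>0. u + v = 1 \<longrightarrow>
        \<Phi> (u *\<^sub>R x + v *\<^sub>R y) \<le> ereal u * \<Phi> x + ereal v * \<Phi> y)"

definition lower_semicontinuous :: "('a::topological_space \<Rightarrow> ereal) \<Rightarrow> bool" where
  "lower_semicontinuous \<Phi> \<longleftrightarrow> (\<forall>x. \<Phi> x \<le> Liminf (at x) \<Phi>)"

definition proper_convex_lsc :: "('a::real_normed_vector \<Rightarrow> ereal) \<Rightarrow> bool" where
  "proper_convex_lsc \<Phi> \<longleftrightarrow> proper \<Phi> \<and> ereal_convex \<Phi> \<and> lower_semicontinuous \<Phi>"

definition cocoercive_on :: "'a::real_inner set \<Rightarrow> real \<Rightarrow> ('a \<Rightarrow> 'a) \<Rightarrow> bool" where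
  "cocoercive_on D \<beta> B \<longleftrightarrow>
     (\<forall>x\<in>D. \<forall>x'\<in>D. inner (B x - B x') (x - x') \<ge> \<beta> * (norm (B x - B x'))\<^sup>2)"

text \<open>
  In \<open>prox\<close> and \<open>proj\<close> the minimiser exists and is unique when, respectively, the function is
  proper, convex and lower semicontinuous with \<open>\<mu> > 0\<close>, and the set is nonempty, closed
  and convex; otherwise \<open>arg_min_on\<close> makes an arbitrary choice.  The library's
  \<open>closest_point\<close> is not used because its type requires the Heine-Borel property.
\<close>

definition prox :: "real \<Rightarrow> ('a::real_inner \<Rightarrow> ereal) \<Rightarrow> 'a \<Rightarrow> 'a" where
  "prox \<mu> \<Phi> x = arg_min_on (\<lambda>u. \<Phi> u + ereal (1 / (2 * \<mu>) * (norm (u - x))\<^sup>2)) UNIV"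

definition proj :: "'a::metric_space set \<Rightarrow> 'a \<Rightarrow> 'a" where
  "proj S x = arg_min_on (\<lambda>u. dist u x) S"

text \<open>For proper \<open>\<Phi>\<close> the following set is empty outside the effective domain of \<open>\<Phi>\<close>.\<close>

definition subdifferential :: "('a::real_inner \<Rightarrow> ereal) \<Rightarrow> 'a \<Rightarrow> 'a set" where
  "subdifferential \<Phi> x = {v. \<forall>y. \<Phi> x + ereal (inner v (y - x)) \<le> \<Phi> y}"

definition zer_sum ::
  "'a::real_inner set \<Rightarrow> ('a \<Rightarrow> ereal) \<Rightarrow> ('a \<Rightarrow> 'a) \<Rightarrow> 'a set" where
  "zer_sum D \<Phi> B = {x\<in>D. 0 \<in> {v + B x | v. v \<in> subdifferential \<Phi> x}}"

text \<open>Absolute continuity on an interval \<open>S\<close>; the library's \<open>absolutely_continuous\<close> is about measures.\<close>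

definition abs_continuous_on :: "real set \<Rightarrow> (real \<Rightarrow> 'a::real_normed_vector) \<Rightarrow> bool" where
  "abs_continuous_on S f \<longleftrightarrow>
     (\<forall>e>0. \<exists>d>0. \<forall>(n::nat) a b.
        (\<forall>k<n. a k \<le> b k \<and> a k \<in> S \<and> b k \<in> S) \<and>
        disjoint_family_on (\<lambda>k. {a k<..<b k}) {..<n} \<and>
        (\<Sum>k<n. b k - a k) < d \<longrightarrow>
        (\<Sum>k<n. norm (f (b k) - f (a k))) < e)"

definition loc_abs_continuous :: "(real \<Rightarrow> 'a::real_normed_vector) \<Rightarrow> bool" where
  "loc_abs_continuous f \<longleftrightarrow> (\<forall>T\<ge>0. abs_continuous_on {0..T} f)"

text \<open>
  Essential limit at plus infinity: the values on a Lebesgue null set are irrelevant.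
\<close>

definition ess_tendsto_at_top :: "(real \<Rightarrow> real) \<Rightarrow> real \<Rightarrow> bool" where
  "ess_tendsto_at_top f l \<longleftrightarrow> (\<forall>e>0. \<exists>T. AE t in lebesgue. t \<ge> T \<longrightarrow> \<bar>f t - l\<bar> < e)"

definition is_solution ::
  "'a::real_normed_vector set \<Rightarrow> (real \<Rightarrow> 'a \<Rightarrow> 'a) \<Rightarrow> 'a \<Rightarrow> (real \<Rightarrow> 'a) \<Rightarrow> bool" where
  "is_solution D F x0 x \<longleftrightarrow>
     loc_abs_continuous x \<and> (\<forall>t\<ge>0. x t \<in> D) \<and> x 0 = x0 \<and>
     (AE t in lebesgue. t \<ge> 0 \<longrightarrow> (x has_vector_derivative F t (x t)) (at t))"

end

theory Submission
  imports Defs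
begin

text \<open>
  Write \<open>T z = prox \<mu> \<Phi> (z - \<mu> B z)\<close> and \<open>T\<^sub>t\<close> for the same map built from \<open>\<Phi>\<^sub>t\<close> and \<open>B\<^sub>t\<close>.  Since the
  proximal operator is nonexpansive and \<open>z - \<mu> B z\<close> is nonexpansive for \<open>\<mu> \<le> 2 \<beta>\<close>, all these maps are
  nonexpansive self-maps of \<open>D\<close>, and the zeros of \<open>\<partial>\<Phi> + B\<close> are the fixed points of \<open>T\<close>.  For \<open>e > 0\<close> let
  \<open>z\<^sub>e\<close> be the regularised fixed point, the solution of \<open>T z - z = e (z - y)\<close> in \<open>D\<close>.  The trajectory
  converges because it is attracted by the moving point \<open>\<xi>(t) = z\<^sub>e\<close> with \<open>e = \<epsilon>(t)\<close>, and this point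
  moves to the required projection.

  Convergence of \<open>z\<^sub>e\<close> as \<open>e \<rightarrow> 0\<close> (\<open>browder_path_tendsto_proj\<close>) rests on the monotonicity of \<open>I - T\<close>, which
  gives \<open>\<parallel>z\<^sub>d - z\<^sub>e\<parallel>\<^sup>2 \<le> \<parallel>z\<^sub>d - y\<parallel>\<^sup>2 - \<parallel>z\<^sub>e - y\<parallel>\<^sup>2\<close> for \<open>d < e\<close>, where the right-hand side is small because
  \<open>\<parallel>z\<^sub>e - y\<parallel>\<close> increases to a finite limit.  Hence the path is Cauchy in norm, and its limit inherits the
  variational inequality that characterises the projection of \<open>y\<close> onto the fixed points.

  The attraction (\<open>tracks_browder_path\<close>) is a differential inequality for \<open>u = \<parallel>x - \<xi>\<parallel>\<close>,
  namely \<open>u' \<le> - \<epsilon> u + \<rho> + \<parallel>\<xi>'\<parallel>\<close> with \<open>\<rho>(t) = \<parallel>T\<^sub>t \<xi>(t) - T \<xi>(t)\<parallel>\<close>.  The points \<open>\<xi>(t)\<close> stay in a compact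
  set, so the hypotheses on \<open>\<kappa>\<close> and \<open>B\<^sub>t\<close> give \<open>\<rho> = o(\<epsilon>)\<close> (\<open>forward_backward_perturbation\<close>).
  Monotonicity gives \<open>e \<parallel>z\<^sub>e - z\<^sub>d\<parallel> \<le> |e - d| \<parallel>z\<^sub>d - y\<parallel>\<close>, so \<open>\<parallel>\<xi>'\<parallel>\<close> is of order \<open>|\<epsilon>'| / \<epsilon> = o(\<epsilon>)\<close>.  Thus
  \<open>u' \<le> - \<epsilon> (u - o(1))\<close>, and the divergence of \<open>\<integral> \<epsilon>\<close> forces \<open>u \<rightarrow> 0\<close> (\<open>eventually_le_of_decay\<close>).

  Two facts of real analysis turn almost-everywhere information into estimates.  An absolutely
  continuous function whose upper derivative is at most zero almost everywhere is nonincreasing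
  (\<open>abs_continuous_on_nonincreasing\<close>).  A continuous monotone function has a derivative almost everywhere
  (\<open>AE_differentiable_mono\<close>); without it the hypothesis on \<open>deriv \<epsilon>\<close> would be empty, since \<open>deriv\<close>
  has an arbitrary value where there is no derivative.  Together they show that \<open>1 / \<epsilon>\<close> is eventually
  Lipschitz with an arbitrarily small constant (\<open>reciprocal_slope_small\<close>).  This bound stands in for
  \<open>\<epsilon>'\<close> in all estimates and makes \<open>\<xi>\<close> locally Lipschitz.
\<close>

section \<open>Absolutely continuous functions on the line\<close>

lemma abs_continuous_on_subset:
  "abs_continuous_on S f \<Longrightarrow> T \<subseteq> S \<Longrightarrow> abs_continuous_on T f"
  unfolding abs_continuous_on_def by (meson subsetD)

text \<open>Increments controlled by those of \<open>g\<close> and of the identity: this covers sums with Lipschitz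
  functions, norms and reciprocals at once.\<close>
lemma abs_continuous_on_dominated:
  fixes f :: "real \<Rightarrow> 'b::real_normed_vector" and g :: "real \<Rightarrow> 'c::real_normed_vector"
  assumes g: "abs_continuous_on S g"
    and dom: "\<And>s t. s \<in> S \<Longrightarrow> t \<in> S \<Longrightarrow> s \<le> t \<Longrightarrow>
      norm (f t - f s) \<le> C * norm (g t - g s) + L * (t - s)"
  shows "abs_continuous_on S f"
  unfolding abs_continuous_on_def
proof (intro allI impI)
  fix e :: real assume "e > 0"
  define M where "M = \<bar>C\<bar> + \<bar>L\<bar> + 1"
  have M: "M > 0" "C \<le> M" "L \<le> M" by (auto simp: M_def)
  obtain d where "d > 0" and d: "\<And>n a b. (\<forall>k<(n::nat). a k \<le> b k \<and> a k \<in> S \<and> b k \<in> S) \<Longrightarrow>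
      disjoint_family_on (\<lambda>k. {a k<..<b k}) {..<n} \<Longrightarrow> (\<Sum>k<n. b k - a k) < d \<Longrightarrow>
      (\<Sum>k<n. norm (g (b k) - g (a k))) < e / (2 * M)"
    using g[unfolded abs_continuous_on_def, rule_format, of "e / (2 * M)"] \<open>e > 0\<close> M by auto
  show "\<exists>d>0. \<forall>(n::nat) a b. (\<forall>k<n. a k \<le> b k \<and> a k \<in> S \<and> b k \<in> S) \<and>
      disjoint_family_on (\<lambda>k. {a k<..<b k}) {..<n} \<and> (\<Sum>k<n. b k - a k) < d \<longrightarrow>
      (\<Sum>k<n. norm (f (b k) - f (a k))) < e"
  proof (intro exI[of _ "min d (e / (2 * M))"] conjI allI impI, goal_cases)
    case 1 show ?case using \<open>d > 0\<close> \<open>e > 0\<close> M by simp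
  next
    case (2 n a b)
    have "(\<Sum>k<n. norm (f (b k) - f (a k)))
        \<le> (\<Sum>k<n. M * norm (g (b k) - g (a k)) + M * (b k - a k))"
    proof (rule sum_mono)
      fix k assume "k \<in> {..<n}"
      then have k: "a k \<le> b k" "a k \<in> S" "b k \<in> S" using 2 by auto
      have "norm (f (b k) - f (a k)) \<le> C * norm (g (b k) - g (a k)) + L * (b k - a k)"
        using k by (intro dom)
      also have "\<dots> \<le> M * norm (g (b k) - g (a k)) + M * (b k - a k)"
        using k M by (intro add_mono mult_right_mono) auto
      finally show "norm (f (b k) - f (a k))
        \<le> M * norm (g (b k) - g (a k)) + M * (b k - a k)" .
    qed
    also have "\<dots> = M * (\<Sum>k<n. norm (g (b k) - g (a k))) + M * (\<Sum>k<n. b k - a k)"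
      by (simp add: sum.distrib sum_distrib_left)
    also have "\<dots> < M * (e / (2 * M)) + M * (e / (2 * M))"
      using 2 M by (intro add_strict_mono mult_strict_left_mono d) auto
    also have "\<dots> = e" using M by simp
    finally show ?case .
  qed
qed

lemma abs_continuous_on_imp_continuous_on:
  assumes "abs_continuous_on S f"
  shows "continuous_on S f"
  unfolding continuous_on_iff
proof (intro ballI allI impI)
  fix s e :: real assume s: "s \<in> S" "e > 0"
  obtain d where "d > 0" and d: "\<And>n a b. (\<forall>k<(n::nat). a k \<le> b k \<and> a k \<in> S \<and> b k \<in> S) \<Longrightarrow>
      disjoint_family_on (\<lambda>k. {a k<..<b k}) {..<n} \<Longrightarrow> (\<Sum>k<n. b k - a k) < d \<Longrightarrow>
      (\<Sum>k<n. norm (f (b k) - f (a k))) < e"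
    using assms[unfolded abs_continuous_on_def, rule_format, of e] s by auto
  have *: "norm (f v - f u) < e" if "u \<in> S" "v \<in> S" "u \<le> v" "v - u < d" for u v
    using d[of 1 "\<lambda>_. u" "\<lambda>_. v"] that by (simp add: disjoint_family_on_def)
  show "\<exists>d>0. \<forall>t\<in>S. dist t s < d \<longrightarrow> dist (f t) (f s) < e"
  proof (intro exI[of _ d] conjI ballI impI)
    fix t assume "t \<in> S" "dist t s < d"
    then show "dist (f t) (f s) < e"
      using *[of s t] *[of t s] s by (cases "s \<le> t") (auto simp: dist_norm norm_minus_commute)
  qed fact
qed

text \<open>
  Cousin's lemma supplies a tagged division that is fine for a gauge chosen in two ways.  At points with
  upper slope at most \<open>0\<close>, the gauge bounds the increment over an interval by a small multiple of its
  length.  The exceptional points lie in an open set of small measure, and the gauge keeps their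
  intervals inside it; absolute continuity then bounds the sum of their increments.
\<close>
lemma abs_continuous_on_nonincreasing:
  fixes f :: "real \<Rightarrow> real"
  assumes ac: "abs_continuous_on {a..b} f" and "a \<le> b"
    and slope: "AE t in lebesgue. a < t \<and> t < b \<longrightarrow>
      (\<forall>e>0. \<forall>\<^sub>F v in at t. (f v - f t) / (v - t) < e)"
  shows "f b \<le> f a"
proof (rule field_le_epsilon)
  fix e :: real assume "e > 0"
  define \<eta> where "\<eta> = e / (2 * (b - a + 1))"
  have \<eta>: "\<eta> > 0" "\<eta> * (b - a) \<le> e / 2"
    using \<open>e > 0\<close> \<open>a \<le> b\<close> by (auto simp: \<eta>_def field_simps)
  define N where "N = {t \<in> {a..b}. \<not> (\<forall>e>0. \<forall>\<^sub>F v in at t. (f v - f t) / (v - t) < e)}"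
  have N: "N \<in> null_sets lebesgue"
  proof -
    have "AE t in lebesgue. t \<notin> N"
      using slope AE_lborel_singleton[of a, THEN AE_completion] AE_lborel_singleton[of b, THEN AE_completion]
      by eventually_elim (auto simp: N_def)
    then show ?thesis by (simp add: AE_iff_null_sets completion.AE_iff_null_sets null_sets_def AE_not_in)
  qed
  obtain d where "d > 0" and d: "\<And>n u v. (\<forall>k<(n::nat). u k \<le> v k \<and> u k \<in> {a..b} \<and> v k \<in> {a..b}) \<Longrightarrow>
      disjoint_family_on (\<lambda>k. {u k<..<v k}) {..<n} \<Longrightarrow> (\<Sum>k<n. v k - u k) < d \<Longrightarrow>
      (\<Sum>k<n. norm (f (v k) - f (u k))) < e / 2"
    using ac[unfolded abs_continuous_on_def, rule_format, of "e / 2"] \<open>e > 0\<close> by auto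
  obtain U where U: "open U" "N \<subseteq> U" "U - N \<in> lmeasurable" "emeasure lebesgue (U - N) < ennreal d"
    using sets_lebesgue_outer_open[of N d] N \<open>d > 0\<close> by auto
  have "emeasure lebesgue U < ennreal d"
  proof -
    have "emeasure lebesgue U = emeasure lebesgue (U - N)"
      using U N by (simp add: emeasure_Diff_null_set)
    then show ?thesis using U by simp
  qed
  then have mU: "emeasure lborel U < ennreal d" using U(1) by simp
  have "\<exists>r>0. (t \<in> N \<longrightarrow> ball t r \<subseteq> U) \<and>
      (t \<in> {a..b} - N \<longrightarrow> (\<forall>v. \<bar>v - t\<bar> < r \<longrightarrow> v \<noteq> t \<longrightarrow> (f v - f t) / (v - t) < \<eta>))" for t
  proof (cases "t \<in> N")
    case True
    then show ?thesis using U by (meson DiffD2 open_contains_ball subsetD)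
  next
    case False
    show ?thesis
    proof (cases "t \<in> {a..b}")
      case True
      with False have "\<forall>\<^sub>F v in at t. (f v - f t) / (v - t) < \<eta>" using \<eta> by (auto simp: N_def)
      then show ?thesis using False by (auto simp: eventually_at dist_real_def)
    qed (use False in \<open>auto intro: exI[of _ 1]\<close>)
  qed
  then obtain r where r: "\<And>t. r t > 0" "\<And>t. t \<in> N \<Longrightarrow> ball t (r t) \<subseteq> U"
    "\<And>t v. t \<in> {a..b} - N \<Longrightarrow> \<bar>v - t\<bar> < r t \<Longrightarrow> v \<noteq> t \<Longrightarrow> (f v - f t) / (v - t) < \<eta>"
    by metis
  have "gauge (\<lambda>t. ball t (r t))" using r(1) by (simp add: gauge_ball_dependent)
  then obtain p where p: "p tagged_division_of {a..b}" and fine: "(\<lambda>t. ball t (r t)) fine p"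
    by (rule fine_division_exists_real)
  note pD = tagged_division_ofD[OF p]
  have K: "\<exists>u v. u \<le> t \<and> t \<le> v \<and> K = {u..v} \<and> Inf K = u \<and> Sup K = v \<and> a \<le> u \<and> v \<le> b
      \<and> {u..v} \<subseteq> ball t (r t)" if tK: "(t, K) \<in> p" for t K
  proof -
    obtain u v where uv: "K = {u..v}" using pD(4)[OF tK] by auto
    moreover have "t \<in> K" "K \<subseteq> {a..b}" using pD(2,3)[OF tK] by auto
    moreover have "K \<subseteq> ball t (r t)" using fine tK by (auto simp: fine_def)
    ultimately show ?thesis by (intro exI[of _ u] exI[of _ v]) auto
  qed
  define q where "q = {x \<in> p. fst x \<in> N}"
  have "q \<subseteq> p" "finite q" "finite p" using pD(1) by (auto simp: q_def)
  \<comment> \<open>Intervals tagged in the null set: their total length is below the measure of \<open>U\<close>.\<close>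
  have bad: "(\<Sum>(t, K)\<in>q. f (Sup K) - f (Inf K)) < e / 2"
  proof -
    obtain h where h: "bij_betw h {..<card q} q"
      using ex_bij_betw_nat_finite[OF \<open>finite q\<close>] by (auto simp: atLeast0LessThan)
    define u v where "u k = Inf (snd (h k))" and "v k = Sup (snd (h k))" for k
    have hk: "h k \<in> q" if "k < card q" for k using h that by (auto simp: bij_betw_def)
    have uv: "u k \<le> v k \<and> u k \<in> {a..b} \<and> v k \<in> {a..b} \<and> snd (h k) = {u k..v k}
        \<and> {u k..v k} \<subseteq> U" if "k < card q" for k
      using K[of "fst (h k)" "snd (h k)"] hk[OF that] r(2)[of "fst (h k)"] \<open>q \<subseteq> p\<close>
      by (auto simp: u_def v_def q_def)
    have disj: "disjoint_family_on (\<lambda>k. {u k<..<v k}) {..<card q}"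
      unfolding disjoint_family_on_def
    proof (intro ballI impI)
      fix k l assume kl: "k \<in> {..<card q}" "l \<in> {..<card q}" "k \<noteq> l"
      then have "h k \<noteq> h l" using h by (auto simp: bij_betw_def inj_on_def)
      then have "interior (snd (h k)) \<inter> interior (snd (h l)) = {}"
        using pD(5)[of "fst (h k)" "snd (h k)" "fst (h l)" "snd (h l)"] hk[of k] hk[of l] kl \<open>q \<subseteq> p\<close>
        by auto
      then show "{u k<..<v k} \<inter> {u l<..<v l} = {}"
        using uv[of k] uv[of l] kl by (auto simp: interior_atLeastAtMost_real)
    qed
    have "ennreal (\<Sum>k<card q. v k - u k) = (\<Sum>k<card q. emeasure lborel {u k<..<v k})"
      using uv by (subst sum_ennreal[symmetric]) auto
    also have "\<dots> = emeasure lborel (\<Union>k\<in>{..<card q}. {u k<..<v k})"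
      using disj by (intro sum_emeasure) auto
    also have "\<dots> \<le> emeasure lborel U"
      using uv U(1) by (intro emeasure_mono) (auto simp: subset_eq intro: less_imp_le)
    also have "\<dots> < ennreal d" by (rule mU)
    finally have "(\<Sum>k<card q. v k - u k) < d"
      using uv \<open>d > 0\<close> by (subst (asm) ennreal_less_iff) (auto intro!: sum_nonneg)
    then have "(\<Sum>k<card q. norm (f (v k) - f (u k))) < e / 2"
      using uv disj by (intro d) auto
    moreover have "(\<Sum>(t, K)\<in>q. f (Sup K) - f (Inf K)) = (\<Sum>k<card q. f (v k) - f (u k))"
      using sum.reindex_bij_betw[OF h, of "\<lambda>(t, K). f (Sup K) - f (Inf K)"]
      by (simp add: u_def v_def case_prod_unfold)
    moreover have "(\<Sum>k<card q. f (v k) - f (u k)) \<le> (\<Sum>k<card q. norm (f (v k) - f (u k)))"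
      by (intro sum_mono) simp
    ultimately show ?thesis by linarith
  qed
  \<comment> \<open>The upper slope at the tag is used on both sides of it, once for each end point.\<close>
  have good: "(\<Sum>(t, K)\<in>p - q. f (Sup K) - f (Inf K)) \<le> e / 2"
  proof -
    have "(\<Sum>(t, K)\<in>p - q. f (Sup K) - f (Inf K)) \<le> (\<Sum>(t, K)\<in>p - q. \<eta> * (Sup K - Inf K))"
    proof (rule sum_mono, clarify)
      fix t K assume "(t, K) \<in> p" "(t, K) \<notin> q"
      then obtain u v where uv: "u \<le> t" "t \<le> v" "Inf K = u" "Sup K = v" "t \<in> {a..b} - N"
          "{u..v} \<subseteq> ball t (r t)"
        using K[of t K] by (fastforce simp: q_def)
      have "u \<in> {u..v}" "v \<in> {u..v}" using uv(1,2) by auto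
      then have "u \<in> ball t (r t)" "v \<in> ball t (r t)" using uv(6) by blast+
      then have "\<bar>u - t\<bar> < r t" "\<bar>v - t\<bar> < r t" by (auto simp: dist_real_def)
      then have slope: "w \<noteq> t \<Longrightarrow> (f w - f t) / (w - t) < \<eta>" if "w = u \<or> w = v" for w
        using r(3)[OF uv(5), of w] that by auto
      have "f v - f t \<le> \<eta> * (v - t)"
        using slope[of v] uv(2) by (cases "v = t") (simp_all add: pos_divide_less_eq)
      moreover have "f t - f u \<le> \<eta> * (t - u)"
        using slope[of u] uv(1) by (cases "u = t") (simp_all add: neg_divide_less_eq algebra_simps)
      ultimately show "f (Sup K) - f (Inf K) \<le> \<eta> * (Sup K - Inf K)"
        using uv by (simp add: algebra_simps)
    qed
    also have "\<dots> \<le> (\<Sum>(t, K)\<in>p. \<eta> * (Sup K - Inf K))"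
    proof (rule sum_mono2)
      fix x assume "x \<in> p - (p - q)"
      then obtain u v where "u \<le> v" "Inf (snd x) = u" "Sup (snd x) = v"
        using K[of "fst x" "snd x"] by auto
      then show "0 \<le> (case x of (t, K) \<Rightarrow> \<eta> * (Sup K - Inf K))"
        using \<eta>(1) by (simp add: case_prod_unfold)
    qed (use \<open>finite p\<close> in auto)
    also have "\<dots> = \<eta> * (b - a)"
      using additive_tagged_division_1[OF \<open>a \<le> b\<close> p, of "\<lambda>t. \<eta> * t"]
      by (simp add: right_diff_distrib)
    finally show ?thesis using \<eta> by simp
  qed
  have "f b - f a = (\<Sum>(t, K)\<in>p. f (Sup K) - f (Inf K))"
    using additive_tagged_division_1[OF \<open>a \<le> b\<close> p, of f] by simp
  also have "\<dots> = (\<Sum>(t, K)\<in>q. f (Sup K) - f (Inf K)) + (\<Sum>(t, K)\<in>p - q. f (Sup K) - f (Inf K))"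
    using sum.subset_diff[OF \<open>q \<subseteq> p\<close> \<open>finite p\<close>] by (simp add: add.commute)
  also have "\<dots> \<le> e" using bad good by simp
  finally show "f b \<le> f a + e" by simp
qed

section \<open>Monotone functions are differentiable almost everywhere\<close>

text \<open>
  The points where the slope over arbitrarily short intervals around the point exceeds \<open>q\<close>.  Using
  intervals that contain the point in the interior makes this a \<open>G\<^sub>\<delta>\<close> set for every \<open>F\<close>.  Slopes below \<open>p\<close>
  are slopes of \<open>- F\<close> above \<open>- p\<close>, so the same set describes lower derivatives.
\<close>
definition steep_points :: "(real \<Rightarrow> real) \<Rightarrow> real \<Rightarrow> real set" where
  "steep_points F q =
     {t. \<forall>d>0. \<exists>a b. a < t \<and> t < b \<and> b - a < d \<and> q * (b - a) < F b - F a}"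

lemma steep_points_borel [measurable]: "steep_points F q \<in> sets borel"
proof -
  define \<U> where "\<U> n = {{a<..<b} | a b.
      b - a < inverse (real (Suc n)) \<and> q * (b - a) < F b - F a}" for n
  have "steep_points F q = (\<Inter>n. \<Union>(\<U> n))"
  proof (rule set_eqI, rule iffI)
    fix t assume t: "t \<in> steep_points F q"
    show "t \<in> (\<Inter>n. \<Union>(\<U> n))"
    proof
      fix n
      have "inverse (real (Suc n)) > 0" by simp
      then obtain a b where "a < t" "t < b" "b - a < inverse (real (Suc n))"
          "q * (b - a) < F b - F a"
        using t unfolding steep_points_def by blast
      then have "{a<..<b} \<in> \<U> n" "t \<in> {a<..<b}" unfolding \<U>_def by auto
      then show "t \<in> \<Union>(\<U> n)" by blast
    qed
  next
    fix t assume t: "t \<in> (\<Inter>n. \<Union>(\<U> n))"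
    show "t \<in> steep_points F q" unfolding steep_points_def
    proof (intro CollectI allI impI)
      fix d :: real assume "d > 0"
      then obtain n where n: "inverse (real (Suc n)) < d" using reals_Archimedean by blast
      have "t \<in> \<Union>(\<U> n)" using t by blast
      then obtain a b where "t \<in> {a<..<b}" "b - a < inverse (real (Suc n))"
          "q * (b - a) < F b - F a" unfolding \<U>_def by blast
      then show "\<exists>a b. a < t \<and> t < b \<and> b - a < d \<and> q * (b - a) < F b - F a"
        using n by (intro exI[of _ a] exI[of _ b]) auto
    qed
  qed
  moreover have "\<Union>(\<U> n) \<in> sets borel" for n
    by (intro borel_open open_Union) (auto simp: \<U>_def)
  ultimately show ?thesis by simp
qed

text \<open>
  On the line every closed interval is a ball around its midpoint, and Vitali's theorem does not ask the
  covered point to be the centre.  The open intervals still cover \<open>S\<close> up to a null set, because only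
  countably many end points are lost; the half-open ones fit the intervals measured by
  \<open>interval_measure\<close>.
\<close>
lemma Vitali_intervals:
  fixes S :: "real set"
  assumes fine: "\<And>t d. t \<in> S \<Longrightarrow> d > 0 \<Longrightarrow> \<exists>a b. a < t \<and> t < b \<and> b - a < d \<and> P a b"
  obtains C where "countable C" "\<And>a b. (a, b) \<in> C \<Longrightarrow> a < b \<and> P a b"
    "disjoint_family_on (\<lambda>i. {fst i<..snd i}) C"
    "S - (\<Union>i\<in>C. {fst i<..<snd i}) \<in> null_sets lebesgue"
proof -
  define K where "K = {(a, b). a < b \<and> P a b}"
  define m r where "m = (\<lambda>(a, b). (a + b) / 2 :: real)" and "r = (\<lambda>(a, b). (b - a) / 2 :: real)"
  have cball: "cball (m i) (r i) = {fst i..snd i}" for i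
    by (cases i) (auto simp: m_def r_def cball_eq_atLeastAtMost field_simps)
  have r_pos: "0 < r i" if "i \<in> K" for i using that by (auto simp: K_def r_def)
  have ex: "\<exists>i. i \<in> K \<and> t \<in> cball (m i) (r i) \<and> r i < d" if td: "t \<in> S" "d > 0" for t d
  proof -
    obtain a b where "a < t" "t < b" "b - a < d" "P a b" using fine[OF td] by blast
    then show ?thesis unfolding cball by (intro exI[of _ "(a, b)"]) (auto simp: K_def r_def)
  qed
  obtain C where C: "countable C" "C \<subseteq> K"
      "pairwise (\<lambda>i j. disjnt (cball (m i) (r i)) (cball (m j) (r j))) C"
      "negligible (S - (\<Union>i\<in>C. cball (m i) (r i)))"
    by (rule Vitali_covering_theorem_cballs[of K r S m, OF r_pos ex that])
  show ?thesis
  proof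
    have "disjoint_family_on (\<lambda>i. {fst i..snd i}) C"
      using C(3) unfolding cball disjoint_family_on_def pairwise_def disjnt_def by blast
    then show "disjoint_family_on (\<lambda>i. {fst i<..snd i}) C"
      by (rule disjoint_family_on_bisimulation) (auto simp: disjoint_iff)
  next
    have "negligible (fst ` C \<union> snd ` C)"
      using C(1) by (auto simp: negligible_iff_null_sets intro!: null_sets_completionI countable_imp_null_set_lborel)
    then have "negligible ((S - (\<Union>i\<in>C. cball (m i) (r i))) \<union> (fst ` C \<union> snd ` C))"
      using C(4) negligible_Un by blast
    then have "negligible (S - (\<Union>i\<in>C. {fst i<..<snd i}))"
    proof (rule negligible_subset, intro subsetI)
      fix t assume t: "t \<in> S - (\<Union>i\<in>C. {fst i<..<snd i})"
      have "t = fst i \<or> t = snd i" if "i \<in> C" "t \<in> {fst i..snd i}" for i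
        using t that by force
      then show "t \<in> (S - (\<Union>i\<in>C. cball (m i) (r i))) \<union> (fst ` C \<union> snd ` C)"
        using t unfolding cball by blast
    qed
    then show "S - (\<Union>i\<in>C. {fst i<..<snd i}) \<in> null_sets lebesgue"
      by (simp add: negligible_iff_null_sets)
  qed (use C in \<open>auto simp: K_def\<close>)
qed


lemma emeasure_interval_measure_eq:
  assumes F: "continuous_on UNIV F" "mono F" and "a \<le> b"
  shows "emeasure (interval_measure F) {a<..b} = ennreal (F b - F a)"
proof (rule emeasure_interval_measure_Ioc[OF \<open>a \<le> b\<close>])
  show "continuous (at_right x) F" for x
    using F(1) by (meson UNIV_I continuous_on_eq_continuous_within continuous_within_subset subset_UNIV)
qed (use F in \<open>auto simp: monoD\<close>)

text \<open>
  If \<open>F\<close> has slopes above \<open>q\<close> near every point of \<open>S\<close>, the Stieltjes measure of any open set around \<open>S\<close>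
  is at least \<open>q\<close> times the Lebesgue measure of \<open>S\<close>: sum over a Vitali cover of \<open>S\<close> by steep intervals.
\<close>
lemma emeasure_steep_le:
  assumes F: "continuous_on UNIV F" "mono F"
    and S: "S \<in> sets lebesgue" "S \<subseteq> steep_points F q" "S \<subseteq> U" and "open U" and "q \<ge> 0"
  shows "ennreal q * emeasure lebesgue S \<le> emeasure (interval_measure F) U"
proof -
  have fine: "\<exists>a b. a < t \<and> t < b \<and> b - a < d \<and> ({a..b} \<subseteq> U \<and> q * (b - a) < F b - F a)"
    if t: "t \<in> S" and "d > 0" for t d
  proof -
    obtain r where r: "r > 0" "ball t r \<subseteq> U"
      using \<open>open U\<close> S(3) t by (meson open_contains_ball subsetD)
    have "min d r > 0" using r \<open>d > 0\<close> by simp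
    then obtain a b where ab: "a < t" "t < b" "b - a < min d r" "q * (b - a) < F b - F a"
      using S(2) t unfolding steep_points_def by blast
    have "{a..b} \<subseteq> ball t r" using ab(1-3) by (auto simp: dist_real_def)
    then show ?thesis using ab r by (intro exI[of _ a] exI[of _ b]) auto
  qed
  obtain C where C: "countable C" "\<And>a b. (a, b) \<in> C \<Longrightarrow> a < b \<and> ({a..b} \<subseteq> U \<and> q * (b - a) < F b - F a)"
    "disjoint_family_on (\<lambda>i. {fst i<..snd i}) C"
    "S - (\<Union>i\<in>C. {fst i<..<snd i}) \<in> null_sets lebesgue"
    using Vitali_intervals[where S = S and P = "\<lambda>a b. {a..b} \<subseteq> U \<and> q * (b - a) < F b - F a", OF fine]
    by blast
  define W where "W = (\<Union>i\<in>C. {fst i<..snd i})"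
  let ?\<nu> = "interval_measure F"
  have W: "W \<in> sets borel" using C(1) by (auto simp: W_def)
  have "S - W \<subseteq> S - (\<Union>i\<in>C. {fst i<..<snd i})" by (force simp: W_def)
  then have null: "S - W \<in> null_sets lebesgue"
    by (intro null_sets_subset[OF C(4)] sets.Diff S(1)) (use W in auto)
  have "emeasure lebesgue S \<le> emeasure lebesgue (W \<union> (S - W))"
    using S(1) W by (intro emeasure_mono) auto
  also have "\<dots> = emeasure lborel W"
    using W null by (subst emeasure_Un_null_set) auto
  finally have "ennreal q * emeasure lebesgue S \<le> ennreal q * emeasure lborel W"
    by (intro mult_left_mono) auto
  also have "\<dots> = ennreal q * (\<integral>\<^sup>+i. emeasure lborel {fst i<..snd i} \<partial>count_space C)"
    unfolding W_def using C(1,3) by (subst emeasure_UN_countable) auto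
  also have "\<dots> = (\<integral>\<^sup>+i. ennreal q * emeasure lborel {fst i<..snd i} \<partial>count_space C)"
    by (rule nn_integral_cmult[symmetric]) auto
  also have "\<dots> \<le> (\<integral>\<^sup>+i. emeasure ?\<nu> {fst i<..snd i} \<partial>count_space C)"
  proof (rule nn_integral_mono)
    fix i assume "i \<in> space (count_space C)"
    then have i: "fst i < snd i" "q * (snd i - fst i) < F (snd i) - F (fst i)"
      using C(2)[of "fst i" "snd i"] by auto
    then show "ennreal q * emeasure lborel {fst i<..snd i} \<le> emeasure ?\<nu> {fst i<..snd i}"
      using \<open>q \<ge> 0\<close>
      by (simp add: emeasure_interval_measure_eq[OF F] ennreal_mult[symmetric] ennreal_leI)
  qed
  also have "\<dots> = emeasure ?\<nu> W"
    unfolding W_def using C(1,3) by (subst emeasure_UN_countable) auto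
  also have "\<dots> \<le> emeasure ?\<nu> U"
  proof (rule emeasure_mono)
    show "W \<subseteq> U" unfolding W_def
    proof
      fix t assume "t \<in> (\<Union>i\<in>C. {fst i<..snd i})"
      then obtain i where i: "i \<in> C" "t \<in> {fst i..snd i}" by auto
      then show "t \<in> U" using C(2)[of "fst i" "snd i"] by auto
    qed
  qed (use \<open>open U\<close> in auto)
  finally show ?thesis .
qed


lemma null_set_of_bounded_parts:
  assumes "S \<in> sets lborel"
    and "\<And>n::nat. emeasure lborel (S \<inter> {- real n<..<real n}) = 0"
  shows "S \<in> null_sets lborel"
proof -
  have "t \<in> (\<Union>n::nat. {- real n<..<real n})" for t
  proof -
    obtain n where "\<bar>t\<bar> < real n" using reals_Archimedean2 by blast
    then show ?thesis by (intro UN_I[of n]) auto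
  qed
  then have "S = (\<Union>n::nat. S \<inter> {- real n<..<real n})" by blast
  moreover have "(\<Union>n::nat. S \<inter> {- real n<..<real n}) \<in> null_sets lborel"
    using assms by (intro null_sets_UN) (auto simp: null_sets_def)
  ultimately show ?thesis by simp
qed

text \<open>
  Where steep and flat intervals both shrink to each point, apply Vitali twice.  Flat intervals inside an
  open set of measure at most \<open>M + e / p\<close> cover the set, so their Stieltjes measure is at most
  \<open>p M + e\<close>; inside them the steep intervals force Stieltjes measure at least \<open>q M\<close>.  As \<open>p < q\<close>, the
  measure \<open>M\<close> vanishes.
\<close>
lemma null_sets_steep_and_flat:
  assumes F: "continuous_on UNIV F" "mono F" and "p < q"
  shows "steep_points F q \<inter> steep_points (\<lambda>t. - F t) (- p) \<in> null_sets lborel"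
    (is "?S \<in> _")
proof (cases "p \<le> 0")
  case True
  have False if t: "t \<in> steep_points (\<lambda>t. - F t) (- p)" for t
  proof -
    obtain a b where ab: "a < t" "t < b" "- p * (b - a) < - F b - - F a"
      using t zero_less_one unfolding steep_points_def by blast
    moreover have "F a \<le> F b" using ab by (intro monoD[OF F(2)]) simp
    moreover have "p * (b - a) \<le> 0" using ab True by (simp add: mult_nonpos_nonneg)
    ultimately show False by simp
  qed
  then have "steep_points (\<lambda>t. - F t) (- p) = {}" by blast
  then show ?thesis by simp
next
  case False
  then have pq: "0 < p" "0 < q" using \<open>p < q\<close> by auto
  show ?thesis
  proof (rule null_set_of_bounded_parts)
    fix n :: nat
    define E where "E = ?S \<inter> {- real n<..<real n}"
    have E[measurable]: "E \<in> sets borel" unfolding E_def by simp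
    have "emeasure lborel E \<le> emeasure lborel {- real n<..<real n}"
      by (intro emeasure_mono) (auto simp: E_def)
    also have "\<dots> < \<infinity>" by simp
    finally obtain M where M: "emeasure lborel E = ennreal M" "M \<ge> 0"
      by (cases "emeasure lborel E") auto
    \<comment> \<open>\<open>M\<close> is finite because \<open>E\<close> is bounded, so \<open>M\<close> can be cancelled at the end.\<close>
    have "q * M \<le> p * M + e" if "e > 0" for e
    proof -
      obtain U where U: "open U" "E \<subseteq> U" "emeasure lebesgue (U - E) < ennreal (e / p)"
      proof (rule sets_lebesgue_outer_open)
        show "E \<in> sets lebesgue" using E by simp
        show "0 < e / p" using pq \<open>e > 0\<close> by simp
      qed (rule that)
      have mU: "emeasure lborel U \<le> ennreal (M + e / p)"
      proof -
        have "emeasure lborel U = emeasure lborel (E \<union> (U - E))"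
          using U(2) by (simp add: Un_absorb1)
        also have "\<dots> \<le> emeasure lborel E + emeasure lborel (U - E)"
          using U(1) by (intro emeasure_subadditive) auto
        also have "\<dots> \<le> ennreal M + ennreal (e / p)"
          using U M by (intro add_mono) auto
        finally show ?thesis using M pq \<open>e > 0\<close> by (simp add: ennreal_plus)
      qed
      have fine: "\<exists>a b. a < t \<and> t < b \<and> b - a < d \<and> ({a..b} \<subseteq> U \<and> F b - F a < p * (b - a))"
        if t: "t \<in> E" and "d > 0" for t d
      proof -
        obtain r where r: "r > 0" "ball t r \<subseteq> U"
          using U t by (meson open_contains_ball subsetD)
        have "min d r > 0" "t \<in> steep_points (\<lambda>t. - F t) (- p)" using r \<open>d > 0\<close> t by (auto simp: E_def)
        then obtain a b where ab: "a < t" "t < b" "b - a < min d r" "- p * (b - a) < - F b - - F a"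
          unfolding steep_points_def by blast
        have "{a..b} \<subseteq> ball t r" using ab(1-3) by (auto simp: dist_real_def)
        then show ?thesis using ab r by (intro exI[of _ a] exI[of _ b]) auto
      qed
      obtain C where C: "countable C"
        "\<And>a b. (a, b) \<in> C \<Longrightarrow> a < b \<and> ({a..b} \<subseteq> U \<and> F b - F a < p * (b - a))"
        "disjoint_family_on (\<lambda>i. {fst i<..snd i}) C"
        "E - (\<Union>i\<in>C. {fst i<..<snd i}) \<in> null_sets lebesgue"
        using Vitali_intervals[where S = E and P = "\<lambda>a b. {a..b} \<subseteq> U \<and> F b - F a < p * (b - a)", OF fine]
        by blast
      define V W where "V = (\<Union>i\<in>C. {fst i<..<snd i})" and "W = (\<Union>i\<in>C. {fst i<..snd i})"
      have VW: "open V" "W \<in> sets borel" "V \<subseteq> W" using C(1) by (auto simp: V_def W_def)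
      let ?\<nu> = "interval_measure F"
      have "W \<subseteq> U" unfolding W_def
      proof
        fix t assume "t \<in> (\<Union>i\<in>C. {fst i<..snd i})"
        then obtain i where i: "i \<in> C" "t \<in> {fst i..snd i}" by auto
        then show "t \<in> U" using C(2)[of "fst i" "snd i"] by auto
      qed
      have "emeasure lborel E = emeasure lebesgue ((E \<inter> V) \<union> (E - V))"
        using E by (simp add: Int_Diff_Un)
      also have "\<dots> = emeasure lebesgue (E \<inter> V)"
        using C(4) VW(1) by (intro emeasure_Un_null_set) (auto simp: V_def)
      finally have "ennreal q * emeasure lborel E = ennreal q * emeasure lebesgue (E \<inter> V)" by simp
      also have "\<dots> \<le> emeasure ?\<nu> V"
        using VW(1) pq by (intro emeasure_steep_le[OF F]) (auto simp: E_def)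
      also have "\<dots> \<le> emeasure ?\<nu> W" using VW by (intro emeasure_mono) auto
      also have "\<dots> = (\<integral>\<^sup>+i. emeasure ?\<nu> {fst i<..snd i} \<partial>count_space C)"
        unfolding W_def using C(1,3) by (subst emeasure_UN_countable) auto
      also have "\<dots> \<le> (\<integral>\<^sup>+i. ennreal p * emeasure lborel {fst i<..snd i} \<partial>count_space C)"
      proof (rule nn_integral_mono)
        fix i assume "i \<in> space (count_space C)"
        then have i: "fst i < snd i" "F (snd i) - F (fst i) < p * (snd i - fst i)"
          using C(2)[of "fst i" "snd i"] by auto
        then show "emeasure ?\<nu> {fst i<..snd i} \<le> ennreal p * emeasure lborel {fst i<..snd i}"
          using pq by (simp add: emeasure_interval_measure_eq[OF F] ennreal_mult[symmetric] ennreal_leI)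
      qed
      also have "\<dots> = ennreal p * (\<integral>\<^sup>+i. emeasure lborel {fst i<..snd i} \<partial>count_space C)"
        by (rule nn_integral_cmult) auto
      also have "\<dots> = ennreal p * emeasure lborel W"
        unfolding W_def using C(1,3) by (subst emeasure_UN_countable) auto
      also have "\<dots> \<le> ennreal p * emeasure lborel U"
        using \<open>W \<subseteq> U\<close> U(1) by (intro mult_left_mono emeasure_mono) auto
      also have "\<dots> \<le> ennreal p * ennreal (M + e / p)"
        using mU by (intro mult_left_mono) auto
      finally have "ennreal (q * M) \<le> ennreal (p * (M + e / p))"
        using M pq \<open>e > 0\<close> by (simp add: ennreal_mult)
      then have "q * M \<le> p * (M + e / p)"
        using M pq \<open>e > 0\<close> by (subst (asm) ennreal_le_iff) auto
      also have "\<dots> = p * M + e" using pq by (simp add: distrib_left)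
      finally show ?thesis .
    qed
    then have "q * M \<le> p * M" by (rule field_le_epsilon)
    then have "(q - p) * M \<le> 0" by (simp add: algebra_simps)
    then have "M \<le> 0" using \<open>p < q\<close> by (simp add: mult_le_0_iff)
    then show "emeasure lborel (?S \<inter> {- real n<..<real n}) = 0"
      using M unfolding E_def[symmetric] by simp
  qed simp
qed

text \<open>The slopes are bounded almost everywhere: on a bounded interval the Stieltjes measure is finite,
  whereas points with unbounded slopes would need \<open>k\<close> times their measure for every \<open>k\<close>.\<close>
lemma AE_not_steep:
  assumes F: "continuous_on UNIV F" "mono F"
  shows "AE t in lborel. \<exists>k::nat. t \<notin> steep_points F (real k)"
proof -
  define S where "S = (\<Inter>k::nat. steep_points F (real k))"
  have [measurable]: "S \<in> sets borel" by (simp add: S_def)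
  have "S \<in> null_sets lborel"
  proof (rule null_set_of_bounded_parts)
    fix n :: nat
    define E where "E = S \<inter> {- real n<..<real n}"
    have E[measurable]: "E \<in> sets borel" unfolding E_def by simp
    have "emeasure lborel E \<le> emeasure lborel {- real n<..<real n}"
      by (intro emeasure_mono) (auto simp: E_def)
    also have "\<dots> < \<infinity>" by simp
    finally obtain M where M: "emeasure lborel E = ennreal M" "M \<ge> 0"
      by (cases "emeasure lborel E") auto
    have "real k * M \<le> F (real n) - F (- real n)" for k :: nat
    proof -
      have "ennreal (real k) * emeasure lebesgue E \<le> emeasure (interval_measure F) {- real n<..<real n}"
        by (rule emeasure_steep_le[OF F]) (auto simp: E_def S_def)
      also have "\<dots> \<le> emeasure (interval_measure F) {- real n<..real n}"
        by (intro emeasure_mono) auto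
      also have "\<dots> = ennreal (F (real n) - F (- real n))"
        by (intro emeasure_interval_measure_eq[OF F]) simp
      finally have "ennreal (real k * M) \<le> ennreal (F (real n) - F (- real n))"
        using M E by (simp add: ennreal_mult)
      then show ?thesis
        using M monoD[OF F(2), of "- real n" "real n"] by (subst (asm) ennreal_le_iff) auto
    qed
    then have "M \<le> 0"
      by (meson ex_less_of_nat_mult linorder_not_le)
    then show "emeasure lborel (S \<inter> {- real n<..<real n}) = 0"
      using M unfolding E_def[symmetric] by simp
  qed simp
  then have "AE t in lborel. t \<notin> S" by (rule AE_not_in)
  then show ?thesis by (simp add: S_def)
qed

lemma not_steep:
  assumes "t \<notin> steep_points F q"
  obtains d where "d > 0" "\<And>a b. a < t \<Longrightarrow> t < b \<Longrightarrow> b - a < d \<Longrightarrow> F b - F a \<le> q * (b - a)"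
proof -
  from assms obtain d where "d > 0"
    "\<not> (\<exists>a b. a < t \<and> t < b \<and> b - a < d \<and> q * (b - a) < F b - F a)"
    unfolding steep_points_def by blast
  then show thesis using that[of d] by (meson not_le)
qed

text \<open>
  Lebesgue's theorem, for continuous monotone functions.  Away from the null sets above, the upper
  slope \<open>D\<close> (an infimum of bounds) is finite and the lower slope is not smaller, since otherwise two
  rational numbers would fit between them.
\<close>
lemma AE_differentiable_mono:
  fixes F :: "real \<Rightarrow> real"
  assumes F: "continuous_on UNIV F" "mono F"
  shows "AE t in lborel. \<exists>D. (F has_real_derivative D) (at t)"
proof -
  have "AE t in lborel. \<forall>p\<in>\<rat>. \<forall>q\<in>\<rat>. p < q \<longrightarrow>
      t \<notin> steep_points F q \<inter> steep_points (\<lambda>t. - F t) (- p)"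
  proof (intro AE_ball_countable[THEN iffD2] ballI countable_rat AE_impI)
    fix p q :: real assume "p < q"
    then show "AE t in lborel. t \<notin> steep_points F q \<inter> steep_points (\<lambda>t. - F t) (- p)"
      using null_sets_steep_and_flat[OF F] by (intro AE_not_in) auto
  qed
  then show ?thesis
    using AE_not_steep[OF F]
  proof eventually_elim
    fix t assume gap: "\<forall>p\<in>\<rat>. \<forall>q\<in>\<rat>. p < q \<longrightarrow>
        t \<notin> steep_points F q \<inter> steep_points (\<lambda>t. - F t) (- p)"
      and fin: "\<exists>k::nat. t \<notin> steep_points F (real k)"
    define Q where "Q = {q. t \<notin> steep_points F q}"
    have "Q \<noteq> {}" using fin by (auto simp: Q_def)
    have Q_nonneg: "0 \<le> q" if "q \<in> Q" for q
    proof (rule ccontr)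
      assume "\<not> 0 \<le> q"
      have "t \<in> steep_points F q" unfolding steep_points_def
      proof (intro CollectI allI impI)
        fix d :: real assume "d > 0"
        moreover have "q * (d / 2) < 0" using \<open>d > 0\<close> \<open>\<not> 0 \<le> q\<close> by (simp add: mult_neg_pos)
        moreover have "F (t - d / 4) \<le> F (t + d / 4)" using \<open>d > 0\<close> by (intro monoD[OF F(2)]) simp
        ultimately show "\<exists>a b. a < t \<and> t < b \<and> b - a < d \<and> q * (b - a) < F b - F a"
          by (intro exI[of _ "t - d / 4"] exI[of _ "t + d / 4"]) auto
      qed
      then show False using that by (simp add: Q_def)
    qed
    then have bdd: "bdd_below Q" by (rule bdd_belowI)
    define D where "D = Inf Q"
    \<comment> \<open>Two rationals \<open>p < p'\<close> below \<open>D\<close>: slopes above \<open>p'\<close> occur, so slopes below \<open>p\<close> do not.\<close>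
    have slopes: "\<exists>d>0. \<forall>a b. a < t \<longrightarrow> t < b \<longrightarrow> b - a < d \<longrightarrow>
        (D - e) * (b - a) \<le> F b - F a \<and> F b - F a \<le> (D + e) * (b - a)" if "e > 0" for e
    proof -
      obtain q where "q \<in> Q" "q < D + e"
        using cInf_lessD[OF \<open>Q \<noteq> {}\<close>, of "D + e"] \<open>e > 0\<close> by (auto simp: D_def)
      then obtain d1 where d1: "d1 > 0"
        "\<And>a b. a < t \<Longrightarrow> t < b \<Longrightarrow> b - a < d1 \<Longrightarrow> F b - F a \<le> q * (b - a)"
        using not_steep[of t F q] unfolding Q_def by blast
      obtain p' where p': "p' \<in> \<rat>" "D - e < p'" "p' < D"
        using Rats_dense_in_real[of "D - e" D] \<open>e > 0\<close> by auto
      obtain p where p: "p \<in> \<rat>" "D - e < p" "p < p'"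
        using Rats_dense_in_real[OF p'(2)] by auto
      have "p' \<notin> Q" using cInf_lower[OF _ bdd, of p'] p'(3) by (auto simp: D_def)
      then have "t \<notin> steep_points (\<lambda>t. - F t) (- p)" using gap p p'(1) by (auto simp: Q_def)
      then obtain d2 where d2: "d2 > 0"
        "\<And>a b. a < t \<Longrightarrow> t < b \<Longrightarrow> b - a < d2 \<Longrightarrow> - F b - - F a \<le> - p * (b - a)"
        using not_steep[of t "\<lambda>t. - F t" "- p"] by blast
      show ?thesis
      proof (intro exI[of _ "min d1 d2"] conjI allI impI)
        fix a b assume ab: "a < t" "t < b" "b - a < min d1 d2"
        have "(D - e) * (b - a) \<le> p * (b - a)" using p ab by (intro mult_right_mono) auto
        also have "\<dots> \<le> F b - F a" using d2(2)[of a b] ab by auto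
        finally show "(D - e) * (b - a) \<le> F b - F a" .
        have "F b - F a \<le> q * (b - a)" using ab by (intro d1) auto
        also have "\<dots> \<le> (D + e) * (b - a)" using \<open>q < D + e\<close> ab by (intro mult_right_mono) auto
        finally show "F b - F a \<le> (D + e) * (b - a)" .
      qed (use d1 d2 in auto)
    qed
    have cont: "isCont F s" for s using F(1) by (simp add: continuous_on_eq_continuous_at)
    have "(F has_real_derivative D) (at t)"
      unfolding has_field_derivative_iff LIM_eq
    proof (intro allI impI)
      fix e :: real assume "e > 0"
      then obtain d where d: "d > 0" "\<And>a b. a < t \<Longrightarrow> t < b \<Longrightarrow> b - a < d \<Longrightarrow>
        (D - e / 2) * (b - a) \<le> F b - F a \<and> F b - F a \<le> (D + e / 2) * (b - a)"
        using slopes[of "e / 2"] by auto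
      \<comment> \<open>The slope bounds hold for intervals around \<open>t\<close>; let the other end point tend to \<open>t\<close>.\<close>
      have right: "(D - e / 2) * (v - t) \<le> F v - F t \<and> F v - F t \<le> (D + e / 2) * (v - t)"
        if "t < v" "v - t < d" for v
      proof -
        have ev: "\<forall>\<^sub>F a in at_left t. a < t \<and> v - a < d"
          using that d(1) by (auto simp: eventually_at_left_field intro!: exI[of _ "v - d"])
        have lim: "((\<lambda>a. F v - F a - c * (v - a)) \<longlongrightarrow> F v - F t - c * (v - t)) (at_left t)" for c
          using cont[of t] by (intro tendsto_intros) (simp_all add: isCont_def filterlim_at_split)
        have "0 \<le> F v - F t - (D - e / 2) * (v - t)"
          using ev by (intro tendsto_lowerbound[OF lim]) (auto elim!: eventually_mono dest!: d(2)[OF _ \<open>t < v\<close>])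
        moreover have "F v - F t - (D + e / 2) * (v - t) \<le> 0"
          using ev by (intro tendsto_upperbound[OF lim]) (auto elim!: eventually_mono dest!: d(2)[OF _ \<open>t < v\<close>])
        ultimately show ?thesis by simp
      qed
      have left: "(D - e / 2) * (t - u) \<le> F t - F u \<and> F t - F u \<le> (D + e / 2) * (t - u)"
        if "u < t" "t - u < d" for u
      proof -
        have ev: "\<forall>\<^sub>F b in at_right t. t < b \<and> b - u < d"
          using that d(1) by (auto simp: eventually_at_right_field intro!: exI[of _ "u + d"])
        have lim: "((\<lambda>b. F b - F u - c * (b - u)) \<longlongrightarrow> F t - F u - c * (t - u)) (at_right t)" for c
          using cont[of t] by (intro tendsto_intros) (simp_all add: isCont_def filterlim_at_split)
        have "0 \<le> F t - F u - (D - e / 2) * (t - u)"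
          using ev by (intro tendsto_lowerbound[OF lim]) (auto elim!: eventually_mono dest!: d(2)[OF \<open>u < t\<close>])
        moreover have "F t - F u - (D + e / 2) * (t - u) \<le> 0"
          using ev by (intro tendsto_upperbound[OF lim]) (auto elim!: eventually_mono dest!: d(2)[OF \<open>u < t\<close>])
        ultimately show ?thesis by simp
      qed
      show "\<exists>s>0. \<forall>v. v \<noteq> t \<and> norm (v - t) < s \<longrightarrow> norm ((F v - F t) / (v - t) - D) < e"
      proof (intro exI[of _ d] conjI allI impI)
        fix v assume v: "v \<noteq> t \<and> norm (v - t) < d"
        then consider "t < v" "v - t < d" | "v < t" "t - v < d" by fastforce
        then show "norm ((F v - F t) / (v - t) - D) < e"
        proof cases
          case 1
          then have "D - e / 2 \<le> (F v - F t) / (v - t)" "(F v - F t) / (v - t) \<le> D + e / 2"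
            using right[of v] by (simp_all add: pos_le_divide_eq pos_divide_le_eq)
          then show ?thesis using \<open>e > 0\<close> unfolding real_norm_def abs_less_iff by linarith
        next
          case 2
          then have "D - e / 2 \<le> (F t - F v) / (t - v)" "(F t - F v) / (t - v) \<le> D + e / 2"
            using left[of v] by (simp_all add: pos_le_divide_eq pos_divide_le_eq)
          moreover have "(F t - F v) / (t - v) = (F v - F t) / (v - t)"
            by (metis minus_diff_eq minus_divide_divide)
          ultimately show ?thesis using \<open>e > 0\<close> unfolding real_norm_def abs_less_iff by linarith
        qed
      qed (rule d(1))
    qed
    then show "\<exists>D. (F has_real_derivative D) (at t)" ..
  qed
qed

section \<open>Differential inequalities and the regularisation parameter\<close>

text \<open>
  Above the level \<open>\<eta>\<close> the function \<open>u + c E\<close> is nonincreasing.  Since \<open>E\<close> tends to infinity and \<open>u \<ge> 0\<close>, the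
  level must be reached; after the last time at which \<open>u \<le> \<eta>\<close>, the function \<open>u\<close> could only decrease,
  so the level is never exceeded again.
\<close>
lemma eventually_le_of_decay:
  fixes u E \<epsilon> :: "real \<Rightarrow> real"
  assumes ac: "\<And>a b. T \<le> a \<Longrightarrow> a \<le> b \<Longrightarrow> abs_continuous_on {a..b} u"
    and u0: "\<And>t. t \<ge> T \<Longrightarrow> 0 \<le> u t"
    and E: "\<And>t. t \<ge> T \<Longrightarrow> (E has_real_derivative \<epsilon> t) (at t)" "filterlim E at_top at_top"
    and \<epsilon>: "\<And>t. t \<ge> T \<Longrightarrow> 0 \<le> \<epsilon> t" "\<And>t. t \<ge> T \<Longrightarrow> \<epsilon> t \<le> L"
    and "c > 0"
    and decay: "AE t in lebesgue. T < t \<longrightarrow> \<eta> < u t \<longrightarrow>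
      (\<forall>e>0. \<forall>\<^sub>F v in at t. (u v - u t) / (v - t) < - c * \<epsilon> t + e)"
  shows "\<forall>\<^sub>F t in at_top. u t \<le> \<eta>"
proof -
  have E_diff: "0 \<le> E b - E a \<and> E b - E a \<le> L * (b - a)" if ab: "T \<le> a" "a \<le> b" for a b
  proof (cases "a = b")
    case False
    then have "a < b" using ab by simp
    then obtain z where z: "a < z" "z < b" "E b - E a = (b - a) * \<epsilon> z"
      using MVT2[of a b E \<epsilon>] E(1) ab by force
    then show ?thesis using \<epsilon>[of z] ab by (auto simp: mult.commute intro: mult_right_mono)
  qed simp
  have drop: "u b + c * E b \<le> u a + c * E a"
    if ab: "T \<le> a" "a \<le> b" and above: "\<And>t. a < t \<Longrightarrow> t < b \<Longrightarrow> \<eta> < u t" for a b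
  proof -
    define f where "f t = u t + c * E t" for t
    have "f b \<le> f a"
    proof (rule abs_continuous_on_nonincreasing[OF _ \<open>a \<le> b\<close>])
      show "abs_continuous_on {a..b} f"
      proof (rule abs_continuous_on_dominated[OF ac[OF ab], of _ 1 "c * L"])
        fix s t assume st: "s \<in> {a..b}" "t \<in> {a..b}" "s \<le> t"
        have "\<bar>c * (E t - E s)\<bar> \<le> c * L * (t - s)"
          using E_diff[of s t] st ab \<open>c > 0\<close> by (simp add: abs_mult mult.assoc)
        moreover have "f t - f s = (u t - u s) + c * (E t - E s)" by (simp add: f_def algebra_simps)
        ultimately show "norm (f t - f s) \<le> 1 * norm (u t - u s) + c * L * (t - s)" by simp
      qed
      show "AE t in lebesgue. a < t \<and> t < b \<longrightarrow> (\<forall>e>0. \<forall>\<^sub>F v in at t. (f v - f t) / (v - t) < e)"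
        using decay
      proof eventually_elim
        case (elim t)
        show ?case
        proof (intro impI allI)
          fix e :: real assume t: "a < t \<and> t < b" and "e > 0"
          have "\<forall>\<^sub>F v in at t. (u v - u t) / (v - t) < - c * \<epsilon> t + e / 2"
            using elim above[of t] t ab \<open>e > 0\<close> by simp
          moreover have "((\<lambda>v. (E v - E t) / (v - t)) \<longlongrightarrow> \<epsilon> t) (at t)"
            using E(1)[of t] t ab by (simp add: has_field_derivative_iff)
          then have "\<forall>\<^sub>F v in at t. (E v - E t) / (v - t) < \<epsilon> t + e / (2 * c)"
            using \<open>e > 0\<close> \<open>c > 0\<close> by (intro order_tendstoD) auto
          ultimately show "\<forall>\<^sub>F v in at t. (f v - f t) / (v - t) < e"
          proof eventually_elim
            case (elim v)
            have "(f v - f t) / (v - t) = (u v - u t) / (v - t) + c * ((E v - E t) / (v - t))"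
              by (simp add: f_def add_divide_distrib diff_divide_distrib right_diff_distrib)
            moreover have "c * ((E v - E t) / (v - t)) < c * (\<epsilon> t + e / (2 * c))"
              using elim(2) \<open>c > 0\<close> by (rule mult_strict_left_mono)
            moreover have "c * (\<epsilon> t + e / (2 * c)) = c * \<epsilon> t + e / 2"
              using \<open>c > 0\<close> by (simp add: distrib_left)
            ultimately show ?case using elim(1) by linarith
          qed
        qed
      qed
    qed
    then show ?thesis by (simp add: f_def)
  qed
  obtain s where s: "T \<le> s" "u s \<le> \<eta>"
  proof -
    have "\<forall>\<^sub>F b in at_top. (u T + c * E T) / c < E b \<and> T \<le> b"
      using E(2) by (auto simp: filterlim_at_top_dense eventually_ge_at_top intro: eventually_conj)
    then obtain b where b: "(u T + c * E T) / c < E b" "T \<le> b"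
      using eventually_happens trivial_limit_at_top_linorder by blast
    show thesis
    proof (rule ccontr)
      assume "\<not> thesis"
      then have "\<And>t. T \<le> t \<Longrightarrow> \<eta> < u t" using that by (meson not_le)
      then have "u b + c * E b \<le> u T + c * E T" using b(2) by (intro drop) auto
      moreover have "u T + c * E T < c * E b" using b(1) \<open>c > 0\<close> by (simp add: pos_divide_less_eq mult.commute)
      ultimately show False using u0[OF b(2)] by linarith
    qed
  qed
  have "u t \<le> \<eta>" if "s \<le> t" for t
  proof (rule ccontr)
    assume "\<not> u t \<le> \<eta>"
    \<comment> \<open>\<open>Sup A\<close> is the last time before \<open>t\<close> at which \<open>u \<le> \<eta>\<close>.\<close>
    define A where "A = {r \<in> {s..t}. u r \<le> \<eta>}"
    have "continuous_on {s..t} u"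
      using ac[OF s(1) that] by (rule abs_continuous_on_imp_continuous_on)
    then have "closed A"
      unfolding A_def by (intro continuous_on_closed_Collect_le continuous_on_const closed_atLeastAtMost)
    moreover have A: "s \<in> A" "bdd_above A" using s that by (auto simp: A_def)
    ultimately have r: "Sup A \<in> A" using closed_contains_Sup by blast
    have "\<eta> < u v" if "Sup A < v" "v < t" for v
    proof (rule ccontr)
      assume "\<not> \<eta> < u v"
      then have "v \<in> A" using r that by (auto simp: A_def)
      then show False using cSup_upper[OF _ A(2)] that by force
    qed
    then have "u t + c * E t \<le> u (Sup A) + c * E (Sup A)"
      using r s(1) by (intro drop) (auto simp: A_def)
    moreover have "c * E (Sup A) \<le> c * E t"
      using E_diff[of "Sup A" t] r s(1) \<open>c > 0\<close> by (intro mult_left_mono) (auto simp: A_def)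
    moreover have "u (Sup A) \<le> \<eta>" using r by (simp add: A_def)
    ultimately show False using \<open>\<not> u t \<le> \<eta>\<close> by linarith
  qed
  then show ?thesis by (auto simp: eventually_at_top_linorder)
qed

text \<open>
  Almost everywhere \<open>(1 / \<epsilon>)' = - \<epsilon>' / \<epsilon>\<^sup>2\<close>, which is eventually below \<open>\<eta>\<close>; absolute continuity turns this
  into a bound for all increments.
\<close>
lemma reciprocal_slope_small:
  assumes pos: "\<And>t. t \<ge> 0 \<Longrightarrow> \<epsilon> t > 0"
    and ac: "abs_continuous_on {0..} \<epsilon>"
    and noninc: "antimono_on {0..} \<epsilon>"
    and deriv: "ess_tendsto_at_top (\<lambda>t. deriv \<epsilon> t / (\<epsilon> t)\<^sup>2) 0"
    and "\<eta> > 0"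
  obtains T where "T \<ge> 0" "\<And>s t. T \<le> s \<Longrightarrow> s \<le> t \<Longrightarrow> 1 / \<epsilon> t - 1 / \<epsilon> s \<le> \<eta> * (t - s)"
proof -
  have cont: "continuous_on {0..} \<epsilon>" using ac by (rule abs_continuous_on_imp_continuous_on)
  have anti: "\<epsilon> t \<le> \<epsilon> s" if "0 \<le> s" "s \<le> t" for s t
    using noninc that by (auto simp: monotone_on_def)
  \<comment> \<open>Constant continuation to the left makes \<open>F\<close> monotone and continuous on the whole line.\<close>
  define F where "F t = 1 / \<epsilon> (max 0 t)" for t
  have F: "F t = 1 / \<epsilon> t" if "t \<ge> 0" for t using that by (simp add: F_def)
  have "continuous_on UNIV (\<lambda>t. \<epsilon> (max 0 t))"
    by (rule continuous_on_compose2[OF cont]) (auto intro!: continuous_intros)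
  moreover have "\<epsilon> (max 0 t) \<noteq> 0" for t using pos[of "max 0 t"] by simp
  ultimately have "continuous_on UNIV F"
    unfolding F_def by (intro continuous_on_divide continuous_on_const) auto
  moreover have "mono F"
    unfolding F_def by (intro monoI divide_left_mono anti mult_pos_pos pos) auto
  ultimately have diff: "AE t in lebesgue. \<exists>d. (F has_real_derivative d) (at t)"
    by (intro AE_completion AE_differentiable_mono)
  obtain T1 where T1: "AE t in lebesgue. t \<ge> T1 \<longrightarrow> \<bar>deriv \<epsilon> t / (\<epsilon> t)\<^sup>2 - 0\<bar> < \<eta>"
    using deriv \<open>\<eta> > 0\<close> unfolding ess_tendsto_at_top_def by blast
  have slope: "AE t in lebesgue. 0 < t \<and> T1 \<le> t \<longrightarrow>
      (\<forall>e>0. \<forall>\<^sub>F v in at t. (F v - F t) / (v - t) < \<eta> + e)"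
    using diff T1
  proof eventually_elim
    case (elim t)
    show ?case
    proof (intro impI allI)
      fix e :: real assume t: "0 < t \<and> T1 \<le> t" and "e > 0"
      obtain d where d: "(F has_real_derivative d) (at t)" using elim(1) by blast
      have Ft: "F t = 1 / \<epsilon> t" "\<epsilon> t > 0" using t pos by (auto simp: F)
      have "((\<lambda>v. inverse (F v)) has_real_derivative - (inverse (F t) * d * inverse (F t))) (at t)"
        using d Ft by (intro DERIV_inverse') auto
      then have "(\<epsilon> has_real_derivative - (inverse (F t) * d * inverse (F t))) (at t)"
      proof (rule has_field_derivative_transform_within_open)
        show "open {0::real<..}" "t \<in> {0<..}" using t by auto
        show "inverse (F v) = \<epsilon> v" if "v \<in> {0<..}" for v using that by (simp add: F inverse_eq_divide)
      qed
      then have "deriv \<epsilon> t = - (inverse (F t) * d * inverse (F t))" by (rule DERIV_imp_deriv)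
      then have "deriv \<epsilon> t / (\<epsilon> t)\<^sup>2 = - d" using Ft by (simp add: power2_eq_square inverse_eq_divide)
      then have "d < \<eta> + e" using elim(2) t \<open>e > 0\<close> by auto
      then show "\<forall>\<^sub>F v in at t. (F v - F t) / (v - t) < \<eta> + e"
        using d unfolding has_field_derivative_iff by (auto intro: order_tendstoD)
    qed
  qed
  show thesis
  proof (rule that[of "max 0 T1"])
    fix s t assume st: "max 0 T1 \<le> s" "s \<le> t"
    define f where "f v = F v - \<eta> * v" for v
    have "f t \<le> f s"
    proof (rule abs_continuous_on_nonincreasing[OF _ \<open>s \<le> t\<close>])
      show "abs_continuous_on {s..t} f"
      proof (rule abs_continuous_on_dominated)
        show "abs_continuous_on {s..t} \<epsilon>"
          using st by (intro abs_continuous_on_subset[OF ac]) auto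
        fix a b assume ab: "a \<in> {s..t}" "b \<in> {s..t}" "a \<le> b"
        have le: "\<epsilon> t \<le> \<epsilon> a" "\<epsilon> t \<le> \<epsilon> b" "\<epsilon> t > 0" using ab st by (auto intro!: anti pos)
        have "F b - F a = (\<epsilon> a - \<epsilon> b) / (\<epsilon> a * \<epsilon> b)"
          using ab st le by (simp add: F field_simps)
        then have "\<bar>F b - F a\<bar> = \<bar>\<epsilon> b - \<epsilon> a\<bar> / (\<epsilon> a * \<epsilon> b)"
          using le by (simp add: abs_divide abs_mult abs_minus_commute)
        also have "\<dots> \<le> \<bar>\<epsilon> b - \<epsilon> a\<bar> / (\<epsilon> t * \<epsilon> t)"
          using le by (intro divide_left_mono mult_mono) auto
        finally have "\<bar>F b - F a\<bar> \<le> 1 / (\<epsilon> t * \<epsilon> t) * \<bar>\<epsilon> b - \<epsilon> a\<bar>" by simp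
        moreover have "\<bar>f b - f a\<bar> \<le> \<bar>F b - F a\<bar> + \<eta> * (b - a)"
        proof -
          have "0 \<le> \<eta> * (b - a)" using ab \<open>\<eta> > 0\<close> by simp
          moreover have "f b - f a = (F b - F a) - \<eta> * (b - a)" by (simp add: f_def algebra_simps)
          ultimately show ?thesis by linarith
        qed
        ultimately show "norm (f b - f a) \<le> 1 / (\<epsilon> t * \<epsilon> t) * norm (\<epsilon> b - \<epsilon> a) + \<eta> * (b - a)"
          by simp
      qed
      show "AE r in lebesgue. s < r \<and> r < t \<longrightarrow> (\<forall>e>0. \<forall>\<^sub>F v in at r. (f v - f r) / (v - r) < e)"
        using slope
      proof eventually_elim
        case (elim r)
        show ?case
        proof (intro impI allI)
          fix e :: real assume r: "s < r \<and> r < t" and "e > 0"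
          then have "\<forall>\<^sub>F v in at r. (F v - F r) / (v - r) < \<eta> + e" using elim st by simp
          moreover have "\<forall>\<^sub>F v in at r. v \<noteq> r" by (simp add: eventually_at_filter)
          ultimately show "\<forall>\<^sub>F v in at r. (f v - f r) / (v - r) < e"
          proof eventually_elim
            case (elim v)
            have "f v - f r = (F v - F r) - \<eta> * (v - r)" by (simp add: f_def algebra_simps)
            then have "(f v - f r) / (v - r) = (F v - F r) / (v - r) - \<eta>"
              using elim(2) by (simp add: diff_divide_distrib)
            then show ?case using elim(1) by simp
          qed
        qed
      qed
    qed
    then show "1 / \<epsilon> t - 1 / \<epsilon> s \<le> \<eta> * (t - s)"
      using st by (simp add: f_def F algebra_simps)
  qed simp
qed

lemma antiderivative_at_top:
  assumes nonneg: "\<And>t. t \<ge> 0 \<Longrightarrow> \<epsilon> t \<ge> 0"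
    and cont: "continuous_on {0..} \<epsilon>"
    and int: "(\<integral>\<^sup>+ s\<in>{0..}. ennreal (\<epsilon> s) \<partial>lebesgue) = \<infinity>"
  obtains E where "\<And>t. t > 0 \<Longrightarrow> (E has_real_derivative \<epsilon> t) (at t)" "filterlim E at_top at_top"
proof -
  define g where "g t = \<epsilon> (max 0 t)" for t
  have g_cont: "continuous_on S g" for S
    unfolding g_def by (rule continuous_on_compose2[OF cont]) (auto intro!: continuous_intros)
  have g: "g t = \<epsilon> t" if "t \<ge> 0" for t using that by (simp add: g_def)
  have g0: "g t \<ge> 0" for t using nonneg[of "max 0 t"] by (simp add: g_def)
  \<comment> \<open>Starting the integral at \<open>-1\<close> gives a two-sided derivative at \<open>0\<close>.\<close>
  define E where "E t = integral {-1..t} g" for t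
  have E: "(E has_real_derivative g t) (at t)" if "t \<ge> 0" for t
  proof -
    have "(E has_real_derivative g t) (at t within {-1..t + 1})"
      unfolding E_def using that by (intro integral_has_real_derivative g_cont) auto
    moreover have "t \<in> interior {-1..t + 1}" using that by (simp add: interior_atLeastAtMost_real)
    ultimately show ?thesis by (simp only: at_within_interior)
  qed
  have mono: "E s \<le> E t" if "0 \<le> s" "s \<le> t" for s t
  proof (rule DERIV_nonneg_imp_nondecreasing[OF that(2)])
    fix v assume "s \<le> v" "v \<le> t"
    then have "(E has_real_derivative g v) (at v)" using that by (intro E) simp
    with g0 show "\<exists>d. (E has_real_derivative d) (at v) \<and> 0 \<le> d" by blast
  qed
  have "filterlim E at_top at_top"
  proof (rule ccontr)
    assume not: "\<not> filterlim E at_top at_top"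
    have "bdd_above (E ` {0..})"
    proof (rule ccontr)
      assume unb: "\<not> bdd_above (E ` {0..})"
      have "\<forall>\<^sub>F t in at_top. Z \<le> E t" for Z
      proof -
        obtain s where "s \<ge> 0" "Z \<le> E s"
          using unb bdd_aboveI[of "E ` {0..}" Z] by (metis atLeast_iff imageE linorder_le_cases)
        then have "Z \<le> E t" if "s \<le> t" for t using mono[of s t] that by simp
        then show ?thesis by (auto simp: eventually_at_top_linorder)
      qed
      then show False using not by (simp add: filterlim_at_top)
    qed
    then have ub: "E t \<le> Sup (E ` {0..})" if "t \<ge> 0" for t using that by (intro cSup_upper) auto
    have lim: "(E \<longlongrightarrow> Sup (E ` {0..})) at_top"
    proof (rule increasing_tendsto)
      show "\<forall>\<^sub>F t in at_top. E t \<le> Sup (E ` {0..})"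
        using eventually_ge_at_top[of 0] by eventually_elim (rule ub)
      fix Z assume "Z < Sup (E ` {0..})"
      then obtain s where "s \<ge> 0" "Z < E s" using less_cSupD[of "E ` {0..}" Z] by auto
      then have "Z < E t" if "s \<le> t" for t using mono[of s t] that by simp
      then show "\<forall>\<^sub>F t in at_top. Z < E t" by (auto simp: eventually_at_top_linorder)
    qed
    have "(\<integral>\<^sup>+ s\<in>{0..}. ennreal (\<epsilon> s) \<partial>lebesgue) = (\<integral>\<^sup>+ s\<in>{0..}. ennreal (g s) \<partial>lebesgue)"
      by (intro nn_integral_cong) (auto simp: g indicator_def)
    also have "\<dots> = (\<integral>\<^sup>+ s\<in>{0..}. ennreal (g s) \<partial>lborel)"
      by (rule nn_integral_completion)
    also have "\<dots> = ennreal (Sup (E ` {0..}) - E 0)"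
      using g_cont[of UNIV] by (intro nn_integral_FTC_atLeast E g0 lim borel_measurable_continuous_onI)
    finally show False using int by simp
  qed
  then show thesis using E g by (intro that[of E]) auto
qed

section \<open>The proximal operator\<close>

lemma lower_semicontinuous_eventually_gt:
  assumes "lower_semicontinuous \<Phi>" "c < \<Phi> x"
  shows "\<forall>\<^sub>F u in nhds x. c < \<Phi> u"
proof -
  have "c < Liminf (at x) \<Phi>"
    using assms by (meson less_le_trans lower_semicontinuous_def)
  then show ?thesis using assms(2) by (simp add: eventually_nhds_conv_at less_LiminfD)
qed

lemma proper_finite:
  assumes "proper \<Phi>" "x \<in> effective_domain \<Phi>"
  obtains r where "\<Phi> x = ereal r"
  using assms by (cases "\<Phi> x") (auto simp: proper_def effective_domain_def)

text \<open>
  Near a point \<open>a\<close> of the domain semicontinuity gives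
  \<open>\<Phi> > \<Phi> a - 1\<close>; a convex function that dropped faster than linearly away from \<open>a\<close> would violate this
  at the point of the segment at distance \<open>r / 2\<close> from \<open>a\<close>.
\<close>
lemma proper_convex_lsc_conic_minorant:
  fixes \<Phi> :: "'a::real_normed_vector \<Rightarrow> ereal"
  assumes "proper_convex_lsc \<Phi>"
  obtains a c C where "C \<ge> 0" "\<And>u. ereal (c - C * norm (u - a)) \<le> \<Phi> u"
proof -
  have pr: "proper \<Phi>" and cv: "ereal_convex \<Phi>" and lsc: "lower_semicontinuous \<Phi>"
    using assms by (auto simp: proper_convex_lsc_def)
  obtain a where "a \<in> effective_domain \<Phi>" using pr by (auto simp: proper_def)
  then obtain \<alpha> where \<alpha>: "\<Phi> a = ereal \<alpha>" by (rule proper_finite[OF pr])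
  have "\<forall>\<^sub>F u in nhds a. ereal (\<alpha> - 1) < \<Phi> u"
    using \<alpha> by (intro lower_semicontinuous_eventually_gt[OF lsc]) simp
  then obtain r where r: "r > 0" "\<And>u. dist u a < r \<Longrightarrow> ereal (\<alpha> - 1) < \<Phi> u"
    by (auto simp: eventually_nhds_metric)
  show thesis
  proof (rule that[of "2 / r" "\<alpha> - 1" a])
    fix u
    show "ereal (\<alpha> - 1 - 2 / r * norm (u - a)) \<le> \<Phi> u"
    proof (cases "dist u a < r")
      case True
      have "ereal (\<alpha> - 1 - 2 / r * norm (u - a)) \<le> ereal (\<alpha> - 1)" using r(1) by simp
      also have "\<dots> \<le> \<Phi> u" using r(2)[OF True] by simp
      finally show ?thesis .
    next
      case far: False
      define n where "n = norm (u - a)"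
      have n: "n \<ge> r" "n > 0" using far r(1) by (auto simp: n_def dist_norm)
      define l where "l = (r / 2) / n"
      have l: "0 < l" "l \<le> 1" using n r(1) by (auto simp: l_def field_simps)
      define w where "w = (1 - l) *\<^sub>R a + l *\<^sub>R u"
      have "w - a = l *\<^sub>R (u - a)" by (simp add: w_def algebra_simps)
      then have "dist w a = l * n" using l by (simp add: dist_norm n_def)
      then have "dist w a < r" using n r(1) by (simp add: l_def)
      then have "ereal (\<alpha> - 1) < \<Phi> w" by (rule r(2))
      also have "\<Phi> w \<le> ereal (1 - l) * \<Phi> a + ereal l * \<Phi> u"
        using cv l by (simp add: ereal_convex_def w_def)
      finally have *: "ereal (\<alpha> - 1) < ereal (1 - l) * \<Phi> a + ereal l * \<Phi> u" .
      show ?thesis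
      proof (cases "\<Phi> u")
        case (real \<nu>)
        then have "\<alpha> - 1 < (1 - l) * \<alpha> + l * \<nu>" using * \<alpha> by simp
        then have "l * (\<alpha> - \<nu>) < 1" by (simp add: algebra_simps)
        then have "\<alpha> - \<nu> < 1 / l" using l by (simp add: pos_less_divide_eq mult.commute)
        also have "1 / l = 2 / r * n" by (simp add: l_def)
        finally show ?thesis using real by (simp add: n_def)
      qed (use pr in \<open>auto simp: proper_def\<close>)
    qed
  qed (use r in simp)
qed

lemma ereal_convex_midpoint:
  assumes "ereal_convex \<Phi>" "\<Phi> u = ereal a" "\<Phi> v = ereal b"
  shows "\<Phi> ((1/2) *\<^sub>R u + (1/2) *\<^sub>R v) \<le> ereal ((a + b) / 2)"
proof -
  have "\<Phi> ((1/2) *\<^sub>R u + (1/2) *\<^sub>R v) \<le> ereal (1/2) * \<Phi> u + ereal (1/2) * \<Phi> v"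
    using assms(1) unfolding ereal_convex_def by simp
  then show ?thesis using assms by (simp add: add_divide_distrib)
qed

text \<open>
  The quadratic term dominates the conic minorant, so the objective is bounded below.  By the
  parallelogram law it is strongly convex, hence a minimising sequence is Cauchy, and lower
  semicontinuity makes its limit a minimiser.
\<close>
lemma prox_objective_minimiser_exists:
  fixes \<Phi> :: "'a::{real_inner, complete_space} \<Rightarrow> ereal"
  assumes \<Phi>: "proper_convex_lsc \<Phi>" and "k > 0"
  shows "\<exists>p. \<forall>u. \<Phi> p + ereal (k * (norm (p - x))\<^sup>2) \<le> \<Phi> u + ereal (k * (norm (u - x))\<^sup>2)"
proof -
  have pr: "proper \<Phi>" and cv: "ereal_convex \<Phi>" and lsc: "lower_semicontinuous \<Phi>"
    using \<Phi> by (auto simp: proper_convex_lsc_def)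
  define S where "S = {v. \<exists>u. \<Phi> u + ereal (k * (norm (u - x))\<^sup>2) = ereal v}"
  obtain a c C where aff: "C \<ge> 0" "\<And>u. ereal (c - C * norm (u - a)) \<le> \<Phi> u"
    by (rule proper_convex_lsc_conic_minorant[OF \<Phi>]) (rule that)
  have lower: "c - C * norm (x - a) - C\<^sup>2 / (4 * k) \<le> v" if "v \<in> S" for v
  proof -
    obtain u where u: "\<Phi> u + ereal (k * (norm (u - x))\<^sup>2) = ereal v" using \<open>v \<in> S\<close> by (auto simp: S_def)
    define s where "s = norm (u - x)"
    have "norm (u - a) \<le> s + norm (x - a)"
      using norm_triangle_ineq[of "u - x" "x - a"] by (simp add: s_def)
    then have "C * norm (u - a) \<le> C * s + C * norm (x - a)"
      using aff(1) by (metis distrib_left mult_left_mono)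
    moreover have "0 \<le> k * (s - C / (2 * k))\<^sup>2" using \<open>k > 0\<close> by simp
    moreover have "k * (s - C / (2 * k))\<^sup>2 = k * s\<^sup>2 - C * s + C\<^sup>2 / (4 * k)"
      using \<open>k > 0\<close> by (simp add: power2_eq_square field_simps)
    ultimately have "C * norm (u - a) \<le> k * s\<^sup>2 + C\<^sup>2 / (4 * k) + C * norm (x - a)" by linarith
    moreover have "ereal (c - C * norm (u - a)) + ereal (k * s\<^sup>2) \<le> ereal v"
      unfolding u[symmetric] s_def by (intro add_mono aff(2)) simp
    ultimately show ?thesis by simp
  qed
  then have bdd: "bdd_below S" by (rule bdd_belowI)
  have "S \<noteq> {}"
  proof -
    obtain a where "a \<in> effective_domain \<Phi>" using pr by (auto simp: proper_def)
    then obtain \<alpha> where "\<Phi> a = ereal \<alpha>" by (rule proper_finite[OF pr])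
    then have "\<alpha> + k * (norm (a - x))\<^sup>2 \<in> S" by (auto simp: S_def intro!: exI[of _ a])
    then show ?thesis by blast
  qed
  define m where "m = Inf S"
  have m: "m \<le> v" if "v \<in> S" for v using cInf_lower[OF that bdd] by (simp add: m_def)
  define \<delta> where "\<delta> n = inverse (real (Suc n))" for n
  have \<delta>: "\<delta> n > 0" for n by (simp add: \<delta>_def)
  have "\<exists>u v. \<Phi> u = ereal v \<and> v + k * (norm (u - x))\<^sup>2 < m + \<delta> n" for n
  proof -
    obtain w where w: "w \<in> S" "w < m + \<delta> n"
      using cInf_lessD[OF \<open>S \<noteq> {}\<close>, of "m + \<delta> n"] \<delta>[of n] by (auto simp: m_def)
    then obtain u where u: "\<Phi> u + ereal (k * (norm (u - x))\<^sup>2) = ereal w" by (auto simp: S_def)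
    then show ?thesis using w by (cases "\<Phi> u") (auto intro!: exI[of _ u])
  qed
  then obtain U V where UV: "\<And>n. \<Phi> (U n) = ereal (V n)"
    "\<And>n. V n + k * (norm (U n - x))\<^sup>2 < m + \<delta> n" by metis
  \<comment> \<open>Compare with the value at the midpoint, which is at least \<open>m\<close>.\<close>
  have gap: "k * (norm (U i - U j))\<^sup>2 \<le> 2 * (\<delta> i + \<delta> j)" for i j
  proof -
    define w where "w = (1/2) *\<^sub>R U i + (1/2) *\<^sub>R U j"
    have \<Phi>w: "\<Phi> w \<le> ereal ((V i + V j) / 2)"
      unfolding w_def by (rule ereal_convex_midpoint[OF cv UV(1) UV(1)])
    then obtain \<omega> where \<omega>: "\<Phi> w = ereal \<omega>" using pr by (cases "\<Phi> w") (auto simp: proper_def)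
    then have "\<omega> + k * (norm (w - x))\<^sup>2 \<in> S" by (auto simp: S_def intro!: exI[of _ w])
    then have "m \<le> \<omega> + k * (norm (w - x))\<^sup>2" by (rule m)
    also have "\<omega> \<le> (V i + V j) / 2" using \<Phi>w \<omega> by simp
    finally have "m \<le> (V i + V j) / 2 + k * (norm (w - x))\<^sup>2" by simp
    moreover have "4 * (norm (w - x))\<^sup>2 = 2 * (norm (U i - x))\<^sup>2 + 2 * (norm (U j - x))\<^sup>2
        - (norm (U i - U j))\<^sup>2"
      unfolding w_def power2_norm_eq_inner by (simp add: algebra_simps inner_commute)
    then have eq: "(norm (w - x))\<^sup>2 = (norm (U i - x))\<^sup>2 / 2 + (norm (U j - x))\<^sup>2 / 2
        - (norm (U i - U j))\<^sup>2 / 4" by simp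
    have "k * (norm (w - x))\<^sup>2 = (k * (norm (U i - x))\<^sup>2) / 2 + (k * (norm (U j - x))\<^sup>2) / 2
        - (k * (norm (U i - U j))\<^sup>2) / 4"
      by (subst eq) (simp add: distrib_left right_diff_distrib)
    ultimately show ?thesis using UV(2)[of i] UV(2)[of j] by argo
  qed
  have "Cauchy U"
  proof (rule metric_CauchyI)
    fix e :: real assume "e > 0"
    then have "k * e\<^sup>2 / 4 > 0" using \<open>k > 0\<close> by simp
    then obtain N where N: "\<delta> N < k * e\<^sup>2 / 4"
      unfolding \<delta>_def using reals_Archimedean by blast
    show "\<exists>M. \<forall>i\<ge>M. \<forall>j\<ge>M. dist (U i) (U j) < e"
    proof (intro exI[of _ N] allI impI)
      fix i j assume "N \<le> i" "N \<le> j"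
      then have "\<delta> i \<le> \<delta> N" "\<delta> j \<le> \<delta> N"
        unfolding \<delta>_def by (intro le_imp_inverse_le; simp)+
      then have "k * (norm (U i - U j))\<^sup>2 < k * e\<^sup>2" using gap[of i j] N by argo
      then have "(norm (U i - U j))\<^sup>2 < e\<^sup>2" using \<open>k > 0\<close> by simp
      then show "dist (U i) (U j) < e" using \<open>e > 0\<close> by (simp add: dist_norm power_less_imp_less_base)
    qed
  qed
  then obtain p where p: "U \<longlonglongrightarrow> p" using Cauchy_convergent_iff convergent_def by blast
  have "\<Phi> p \<le> ereal (m - k * (norm (p - x))\<^sup>2)"
  proof (rule ccontr)
    assume "\<not> ?thesis"
    then obtain c where c: "m - k * (norm (p - x))\<^sup>2 < c" "ereal c < \<Phi> p"
      using ereal_dense2[of "ereal (m - k * (norm (p - x))\<^sup>2)" "\<Phi> p"] by (auto simp: not_le)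
    have "\<forall>\<^sub>F n in sequentially. ereal c < \<Phi> (U n)"
      by (rule eventually_compose_filterlim[OF lower_semicontinuous_eventually_gt[OF lsc c(2)] p])
    then have "\<forall>\<^sub>F n in sequentially. c + k * (norm (U n - x))\<^sup>2 \<le> m + \<delta> n"
    proof eventually_elim
      case (elim n)
      then have "c < V n" by (simp add: UV(1))
      then show ?case using UV(2)[of n] by simp
    qed
    moreover have "(\<lambda>n. c + k * (norm (U n - x))\<^sup>2) \<longlonglongrightarrow> c + k * (norm (p - x))\<^sup>2"
      by (intro tendsto_intros p)
    moreover have "(\<lambda>n. m + \<delta> n) \<longlonglongrightarrow> m + 0"
      unfolding \<delta>_def by (intro tendsto_intros LIMSEQ_inverse_real_of_nat)
    ultimately have "c + k * (norm (p - x))\<^sup>2 \<le> m + 0"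
      by (intro tendsto_le[OF sequentially_bot]) auto
    then show False using c(1) by simp
  qed
  then have le_m: "\<Phi> p + ereal (k * (norm (p - x))\<^sup>2) \<le> ereal m"
    using pr by (cases "\<Phi> p") (auto simp: proper_def)
  have "\<Phi> p + ereal (k * (norm (p - x))\<^sup>2) \<le> \<Phi> u + ereal (k * (norm (u - x))\<^sup>2)" for u
  proof (cases "\<Phi> u")
    case (real v)
    then have "v + k * (norm (u - x))\<^sup>2 \<in> S" by (auto simp: S_def intro!: exI[of _ u])
    then show ?thesis using order_trans[OF le_m, of "ereal (v + k * (norm (u - x))\<^sup>2)"] m real by simp
  qed (use pr in \<open>auto simp: proper_def\<close>)
  then show ?thesis by blast
qed

lemma subdifferential_effective_domain:
  assumes "proper \<Phi>" "v \<in> subdifferential \<Phi> x"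
  shows "x \<in> effective_domain \<Phi>"
proof -
  obtain a where "\<Phi> a < \<infinity>" using assms(1) by (auto simp: proper_def effective_domain_def)
  moreover have "\<Phi> x + ereal (inner v (a - x)) \<le> \<Phi> a" using assms(2) by (simp add: subdifferential_def)
  ultimately show ?thesis by (cases "\<Phi> x") (auto simp: effective_domain_def)
qed

lemma subdifferential_monotone:
  assumes "proper \<Phi>" "v \<in> subdifferential \<Phi> x" "w \<in> subdifferential \<Phi> y"
  shows "inner (v - w) (x - y) \<ge> 0"
proof -
  obtain a b where ab: "\<Phi> x = ereal a" "\<Phi> y = ereal b"
    using assms by (metis proper_finite subdifferential_effective_domain)
  have "\<Phi> x + ereal (inner v (y - x)) \<le> \<Phi> y" "\<Phi> y + ereal (inner w (x - y)) \<le> \<Phi> x"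
    using assms by (simp_all add: subdifferential_def)
  then have "a + inner v (y - x) \<le> b" "b + inner w (x - y) \<le> a" using ab by simp_all
  then show ?thesis by (simp add: algebra_simps)
qed

lemma power2_norm_add_scaleR:
  fixes a b :: "'a::real_inner"
  shows "(norm (a + l *\<^sub>R b))\<^sup>2 = (norm a)\<^sup>2 + 2 * l * inner a b + l\<^sup>2 * (norm b)\<^sup>2"
  unfolding power2_norm_eq_inner
  by (simp add: inner_add_left inner_add_right inner_commute[of b a] power2_eq_square algebra_simps)

text \<open>Optimality condition: compare the minimiser \<open>p\<close> with \<open>p + l (y - p)\<close>, divide by \<open>l\<close> and
  let \<open>l\<close> tend to \<open>0\<close>.\<close>
lemma prox_subgradient:
  fixes \<Phi> :: "'a::{real_inner, complete_space} \<Rightarrow> ereal"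
  assumes \<Phi>: "proper_convex_lsc \<Phi>" and "\<mu> > 0"
  shows "(1 / \<mu>) *\<^sub>R (x - prox \<mu> \<Phi> x) \<in> subdifferential \<Phi> (prox \<mu> \<Phi> x)"
proof -
  have pr: "proper \<Phi>" and cv: "ereal_convex \<Phi>"
    using \<Phi> by (auto simp: proper_convex_lsc_def)
  define k where "k = 1 / (2 * \<mu>)"
  have "k > 0" using \<open>\<mu> > 0\<close> by (simp add: k_def)
  let ?G = "\<lambda>u. \<Phi> u + ereal (k * (norm (u - x))\<^sup>2)"
  define p where "p = prox \<mu> \<Phi> x"
  obtain q where "\<And>u. ?G q \<le> ?G u"
    using prox_objective_minimiser_exists[OF \<Phi> \<open>k > 0\<close>] by blast
  then have "is_arg_min ?G (\<lambda>u. u \<in> UNIV) q" by (simp add: is_arg_min_def not_less)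
  then have "is_arg_min ?G (\<lambda>u. u \<in> UNIV) p"
    unfolding p_def prox_def arg_min_on_def arg_min_def k_def by (rule someI)
  then have p: "?G p \<le> ?G u" for u by (simp add: is_arg_min_def not_less)
  obtain a where "a \<in> effective_domain \<Phi>" using pr by (auto simp: proper_def)
  then have "p \<in> effective_domain \<Phi>"
    using p[of a] by (cases "\<Phi> p") (auto simp: effective_domain_def)
  then obtain \<pi> where \<pi>: "\<Phi> p = ereal \<pi>" by (rule proper_finite[OF pr])
  have "\<Phi> p + ereal (inner ((1 / \<mu>) *\<^sub>R (x - p)) (y - p)) \<le> \<Phi> y" for y
  proof (cases "\<Phi> y")
    case (real \<upsilon>)
    have "\<pi> - \<upsilon> \<le> 2 * k * inner (p - x) (y - p) + l * (k * (norm (y - p))\<^sup>2)"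
      if l: "0 < l" "l < 1" for l
    proof -
      define z where "z = (1 - l) *\<^sub>R p + l *\<^sub>R y"
      have "\<Phi> z \<le> ereal (1 - l) * \<Phi> p + ereal l * \<Phi> y"
        using cv l by (simp add: ereal_convex_def z_def)
      then have "?G z \<le> ereal ((1 - l) * \<pi> + l * \<upsilon> + k * (norm (z - x))\<^sup>2)"
        using \<pi> real by (cases "\<Phi> z") auto
      then have le: "\<pi> + k * (norm (p - x))\<^sup>2 \<le> (1 - l) * \<pi> + l * \<upsilon> + k * (norm (z - x))\<^sup>2"
        using order_trans[OF p[of z]] \<pi> by fastforce
      have zx: "z - x = (p - x) + l *\<^sub>R (y - p)" by (simp add: z_def algebra_simps)
      have "l * (\<pi> - \<upsilon>) \<le> k * ((norm (z - x))\<^sup>2 - (norm (p - x))\<^sup>2)"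
        using le by (simp add: algebra_simps)
      also have "(norm (z - x))\<^sup>2 - (norm (p - x))\<^sup>2 = 2 * l * inner (p - x) (y - p) + l\<^sup>2 * (norm (y - p))\<^sup>2"
        unfolding zx power2_norm_add_scaleR by simp
      also have "k * \<dots> = l * (2 * k * inner (p - x) (y - p) + l * (k * (norm (y - p))\<^sup>2))"
        by (simp add: power2_eq_square distrib_left mult.left_commute mult.assoc)
      finally have "l * (\<pi> - \<upsilon>) \<le> l * (2 * k * inner (p - x) (y - p) + l * (k * (norm (y - p))\<^sup>2))" .
      then show ?thesis using l by simp
    qed
    then have "\<forall>\<^sub>F l in at_right 0. \<pi> - \<upsilon> \<le> 2 * k * inner (p - x) (y - p) + l * (k * (norm (y - p))\<^sup>2)"
      by (auto simp: eventually_at_right_field intro!: exI[of _ 1])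
    moreover have "((\<lambda>l. 2 * k * inner (p - x) (y - p) + l * (k * (norm (y - p))\<^sup>2)) \<longlongrightarrow>
        2 * k * inner (p - x) (y - p) + 0 * (k * (norm (y - p))\<^sup>2)) (at_right 0)"
      by (intro tendsto_intros)
    ultimately have "\<pi> - \<upsilon> \<le> 2 * k * inner (p - x) (y - p) + 0 * (k * (norm (y - p))\<^sup>2)"
      by (intro tendsto_lowerbound) auto
    moreover have "2 * k = 1 / \<mu>" by (simp add: k_def)
    moreover have "inner (x - p) (y - p) = - inner (p - x) (y - p)" by (simp add: inner_diff_left)
    ultimately show ?thesis using \<pi> real by simp
  qed (use pr in \<open>auto simp: proper_def\<close>)
  then show ?thesis by (simp add: subdifferential_def p_def)
qed

lemma prox_in_effective_domain:
  fixes \<Phi> :: "'a::{real_inner, complete_space} \<Rightarrow> ereal"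
  assumes "proper_convex_lsc \<Phi>" "\<mu> > 0"
  shows "prox \<mu> \<Phi> x \<in> effective_domain \<Phi>"
  using subdifferential_effective_domain prox_subgradient[OF assms] assms(1)
  unfolding proper_convex_lsc_def by blast

text \<open>A point satisfying the optimality condition is the value of \<open>prox\<close>, because monotonicity
  of the subdifferential makes such a point unique; this holds for any choice that \<open>arg_min_on\<close> makes.\<close>
lemma prox_eq_iff:
  fixes \<Phi> :: "'a::{real_inner, complete_space} \<Rightarrow> ereal"
  assumes \<Phi>: "proper_convex_lsc \<Phi>" and "\<mu> > 0"
  shows "prox \<mu> \<Phi> x = p \<longleftrightarrow> (1 / \<mu>) *\<^sub>R (x - p) \<in> subdifferential \<Phi> p"
proof
  assume p: "(1 / \<mu>) *\<^sub>R (x - p) \<in> subdifferential \<Phi> p"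
  define q where "q = prox \<mu> \<Phi> x"
  have "0 \<le> inner ((1 / \<mu>) *\<^sub>R (x - p) - (1 / \<mu>) *\<^sub>R (x - q)) (p - q)"
    using \<Phi> p prox_subgradient[OF \<Phi> \<open>\<mu> > 0\<close>, of x]
    by (intro subdifferential_monotone) (auto simp: q_def proper_convex_lsc_def)
  also have "(1 / \<mu>) *\<^sub>R (x - p) - (1 / \<mu>) *\<^sub>R (x - q) = - (1 / \<mu>) *\<^sub>R (p - q)"
    by (simp add: algebra_simps)
  finally have "inner (p - q) (p - q) \<le> 0"
    using \<open>\<mu> > 0\<close> by (simp add: divide_le_0_iff)
  then show "prox \<mu> \<Phi> x = p" by (simp add: q_def power2_norm_eq_inner[symmetric])
qed (use prox_subgradient[OF assms] in auto)

lemma prox_nonexpansive: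
  fixes \<Phi> :: "'a::{real_inner, complete_space} \<Rightarrow> ereal"
  assumes \<Phi>: "proper_convex_lsc \<Phi>" and "\<mu> > 0"
  shows "norm (prox \<mu> \<Phi> x - prox \<mu> \<Phi> y) \<le> norm (x - y)"
proof -
  define p q where "p = prox \<mu> \<Phi> x" and "q = prox \<mu> \<Phi> y"
  have "0 \<le> inner ((1 / \<mu>) *\<^sub>R (x - p) - (1 / \<mu>) *\<^sub>R (y - q)) (p - q)"
    using \<Phi> prox_subgradient[OF \<Phi> \<open>\<mu> > 0\<close>]
    by (intro subdifferential_monotone) (auto simp: p_def q_def proper_convex_lsc_def)
  also have "(1 / \<mu>) *\<^sub>R (x - p) - (1 / \<mu>) *\<^sub>R (y - q) = (1 / \<mu>) *\<^sub>R ((x - y) - (p - q))"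
    by (simp add: algebra_simps)
  finally have "0 \<le> inner ((x - y) - (p - q)) (p - q)"
    using \<open>\<mu> > 0\<close> by (simp add: zero_le_divide_iff)
  then have "(norm (p - q))\<^sup>2 \<le> inner (x - y) (p - q)"
    by (simp add: power2_norm_eq_inner inner_diff_left)
  also have "\<dots> \<le> norm (x - y) * norm (p - q)" by (rule norm_cauchy_schwarz)
  finally have "norm (p - q) * norm (p - q) \<le> norm (x - y) * norm (p - q)" by (simp add: power2_eq_square)
  then show ?thesis
    unfolding p_def[symmetric] q_def[symmetric]
    by (cases "norm (p - q) = 0") (simp, metis mult_right_le_imp_le norm_ge_zero order_le_less)
qed

section \<open>Regularised fixed points of a nonexpansive map\<close>

text \<open>The variational inequality gives \<open>\<parallel>z - y\<parallel>\<^sup>2 + \<parallel>q - z\<parallel>\<^sup>2 \<le> \<parallel>q - y\<parallel>\<^sup>2\<close>, so \<open>z\<close> is the only minimiser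
  of the distance and \<open>arg_min_on\<close> has to choose it.\<close>
lemma proj_eqI:
  fixes y :: "'a::real_inner"
  assumes "z \<in> S" and vi: "\<And>q. q \<in> S \<Longrightarrow> inner (z - y) (z - q) \<le> 0"
  shows "proj S y = z"
proof -
  have *: "(dist z y)\<^sup>2 + (dist q z)\<^sup>2 \<le> (dist q y)\<^sup>2" if "q \<in> S" for q
  proof -
    have "q - y = (z - y) + 1 *\<^sub>R (q - z)" by simp
    then have "(norm (q - y))\<^sup>2 = (norm (z - y))\<^sup>2 + 2 * 1 * inner (z - y) (q - z) + 1\<^sup>2 * (norm (q - z))\<^sup>2"
      by (metis power2_norm_add_scaleR)
    moreover have "inner (z - y) (q - z) = - inner (z - y) (z - q)" by (simp add: inner_diff_right)
    ultimately show ?thesis using vi[OF that] by (simp add: dist_norm)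
  qed
  have min: "dist z y \<le> dist q y" if "q \<in> S" for q
  proof (rule power2_le_imp_le)
    show "(dist z y)\<^sup>2 \<le> (dist q y)\<^sup>2" using *[OF that] zero_le_power2[of "dist q z"] by linarith
  qed simp
  then have "is_arg_min (\<lambda>u. dist u y) (\<lambda>u. u \<in> S) z"
    using \<open>z \<in> S\<close> by (auto simp: is_arg_min_def not_less)
  then have "is_arg_min (\<lambda>u. dist u y) (\<lambda>u. u \<in> S) (proj S y)"
    unfolding proj_def arg_min_on_def arg_min_def by (rule someI)
  then have q: "proj S y \<in> S" "dist (proj S y) y \<le> dist z y"
    using \<open>z \<in> S\<close> by (auto simp: is_arg_min_def not_less)
  have "(dist (proj S y) y)\<^sup>2 \<le> (dist z y)\<^sup>2" using q(2) by (intro power_mono) auto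
  then have "(dist (proj S y) z)\<^sup>2 \<le> 0" using *[OF q(1)] by linarith
  then show ?thesis by simp
qed

locale anchored_nonexpansive =
  fixes D :: "'a::{real_inner, complete_space} set" and T :: "'a \<Rightarrow> 'a" and y :: 'a
  assumes closed_D: "closed D" and convex_D: "convex D" and y_D: "y \<in> D"
    and T_D: "x \<in> D \<Longrightarrow> T x \<in> D"
    and T_nonexpansive: "x \<in> D \<Longrightarrow> x' \<in> D \<Longrightarrow> norm (T x - T x') \<le> norm (x - x')"
begin

text \<open>The regularised fixed points; the equation has exactly one solution in \<open>D\<close> when \<open>e > 0\<close>.\<close>
definition browder_path :: "real \<Rightarrow> 'a" where
  "browder_path e = (SOME z. z \<in> D \<and> T z - z = e *\<^sub>R (z - y))"

text \<open>The equation says that \<open>z\<close> is fixed by \<open>(T z + e y) / (1 + e)\<close>, a contraction of \<open>D\<close> with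
  constant \<open>1 / (1 + e)\<close>.\<close>
lemma browder_path:
  assumes "e > 0"
  shows browder_path_in: "browder_path e \<in> D" and browder_path_eq: "T (browder_path e) - browder_path e = e *\<^sub>R (browder_path e - y)"
proof -
  define f where "f z = (1 / (1 + e)) *\<^sub>R T z + (e / (1 + e)) *\<^sub>R y" for z
  have c: "0 \<le> 1 / (1 + e)" "0 \<le> e / (1 + e)" "1 / (1 + e) + e / (1 + e) = 1" "1 / (1 + e) < 1"
    using assms by (auto simp: field_simps)
  have "\<exists>!z\<in>D. f z = z"
  proof (rule Banach_fix[OF _ _ c(1) c(4)])
    show "complete D" using closed_D by (simp add: complete_eq_closed)
    show "f ` D \<subseteq> D" unfolding f_def using c by (auto intro!: convexD[OF convex_D] T_D y_D)
    show "dist (f z) (f w) \<le> 1 / (1 + e) * dist z w" if "z \<in> D" "w \<in> D" for z w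
    proof -
      have "f z - f w = (1 / (1 + e)) *\<^sub>R (T z - T w)" by (simp add: f_def algebra_simps)
      then have "dist (f z) (f w) = 1 / (1 + e) * norm (T z - T w)" using assms by (simp add: dist_norm)
      also have "\<dots> \<le> 1 / (1 + e) * norm (z - w)"
        using c by (intro mult_left_mono T_nonexpansive that)
      finally show ?thesis by (simp add: dist_norm)
    qed
  qed (use y_D in auto)
  then obtain z where z: "z \<in> D" "f z = z" by blast
  have "(1 + e) *\<^sub>R f z = T z + e *\<^sub>R y"
    using assms by (simp add: f_def scaleR_add_right)
  then have "T z - z = e *\<^sub>R (z - y)" unfolding z(2) by (simp add: algebra_simps)
  with z have "z \<in> D \<and> T z - z = e *\<^sub>R (z - y)" by simp
  then have "browder_path e \<in> D \<and> T (browder_path e) - browder_path e = e *\<^sub>R (browder_path e - y)"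
    unfolding browder_path_def by (rule someI)
  then show "browder_path e \<in> D" "T (browder_path e) - browder_path e = e *\<^sub>R (browder_path e - y)" by auto
qed

lemma displacement_monotone:
  assumes "x \<in> D" "x' \<in> D"
  shows "inner ((T x - x) - (T x' - x')) (x - x') \<le> 0"
proof -
  have "inner (T x - T x') (x - x') \<le> norm (T x - T x') * norm (x - x')" by (rule norm_cauchy_schwarz)
  also have "\<dots> \<le> norm (x - x') * norm (x - x')"
    using assms by (intro mult_right_mono T_nonexpansive) auto
  finally have "inner (T x - T x') (x - x') \<le> inner (x - x') (x - x')"
    by (simp add: power2_norm_eq_inner[symmetric] power2_eq_square)
  moreover have "(T x - x) - (T x' - x') = (T x - T x') - (x - x')" by simp
  ultimately show ?thesis by (simp only: inner_diff_left)
qed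

lemma browder_path_variational:
  assumes "e > 0" "q \<in> D" "T q = q"
  shows "inner (browder_path e - y) (browder_path e - q) \<le> 0"
proof -
  have "e * inner (browder_path e - y) (browder_path e - q) \<le> 0"
    using displacement_monotone[OF browder_path_in[OF assms(1)] assms(2)] assms by (simp add: browder_path_eq)
  then show ?thesis using \<open>e > 0\<close> by (simp add: mult_le_0_iff)
qed

lemma browder_path_bounded:
  assumes "e > 0" "q \<in> D" "T q = q"
  shows "norm (browder_path e - y) \<le> norm (q - y)"
proof -
  have "inner (browder_path e - y) (browder_path e - q) \<le> 0" using assms by (rule browder_path_variational)
  moreover have "browder_path e - q = (browder_path e - y) - (q - y)" by simp
  ultimately have "(norm (browder_path e - y))\<^sup>2 \<le> inner (browder_path e - y) (q - y)"
    by (simp only: power2_norm_eq_inner inner_diff_right[of "browder_path e - y" "browder_path e - y"])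
  also have "\<dots> \<le> norm (browder_path e - y) * norm (q - y)" by (rule norm_cauchy_schwarz)
  finally have "norm (browder_path e - y) * norm (browder_path e - y) \<le> norm (browder_path e - y) * norm (q - y)"
    by (simp add: power2_eq_square)
  then show ?thesis
    by (cases "norm (browder_path e - y) = 0") (simp, metis mult_left_le_imp_le norm_ge_zero order_le_less)
qed

text \<open>Monotonicity of \<open>I - T\<close> at two points of the path; the Lipschitz estimate and the Cauchy
  estimate below are both read off from it.\<close>
lemma browder_path_two_parameters:
  assumes "e > 0" "d > 0"
  shows "inner (e *\<^sub>R (browder_path e - y) - d *\<^sub>R (browder_path d - y)) (browder_path e - browder_path d) \<le> 0"
  using displacement_monotone[OF browder_path_in browder_path_in, OF assms] assms by (simp add: browder_path_eq)

lemma browder_path_lipschitz: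
  assumes "e > 0" "d > 0"
  shows "e * norm (browder_path e - browder_path d) \<le> \<bar>e - d\<bar> * norm (browder_path d - y)"
proof -
  define a b where "a = browder_path e - browder_path d" and "b = browder_path d - y"
  have "e *\<^sub>R (browder_path e - y) - d *\<^sub>R (browder_path d - y) = e *\<^sub>R a + (e - d) *\<^sub>R b"
    by (simp add: a_def b_def algebra_simps)
  then have "inner (e *\<^sub>R a + (e - d) *\<^sub>R b) a \<le> 0"
    using browder_path_two_parameters[OF assms] by (simp add: a_def)
  then have "e * (norm a)\<^sup>2 \<le> - ((e - d) * inner b a)"
    by (simp add: inner_add_left power2_norm_eq_inner)
  also have "\<dots> \<le> \<bar>e - d\<bar> * \<bar>inner b a\<bar>" by (metis abs_ge_minus_self abs_mult)
  also have "\<dots> \<le> \<bar>e - d\<bar> * (norm b * norm a)"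
    by (intro mult_left_mono Cauchy_Schwarz_ineq2) auto
  finally have "norm a * (e * norm a) \<le> norm a * (\<bar>e - d\<bar> * norm b)"
    by (simp add: power2_eq_square mult_ac)
  then have "e * norm a \<le> \<bar>e - d\<bar> * norm b"
    by (cases "norm a = 0") (simp, metis mult_left_le_imp_le norm_ge_zero order_le_less)
  then show ?thesis by (simp add: a_def b_def)
qed

text \<open>The norm \<open>\<parallel>z\<^sub>e - y\<parallel>\<close> grows as \<open>e\<close> decreases, and its growth controls the distance between the
  points.  This is the reason for norm convergence.\<close>
lemma browder_path_gap:
  assumes "0 < d" "d < e"
  shows "(norm (browder_path d - browder_path e))\<^sup>2 \<le> (norm (browder_path d - y))\<^sup>2 - (norm (browder_path e - y))\<^sup>2"
proof -
  define a b where "a = browder_path e - y" and "b = browder_path d - browder_path e"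
  have pd: "browder_path d - y = a + 1 *\<^sub>R b" by (simp add: a_def b_def)
  have "e *\<^sub>R (browder_path e - y) - d *\<^sub>R (browder_path d - y) = (e - d) *\<^sub>R a - d *\<^sub>R b"
    unfolding pd by (simp add: a_def algebra_simps)
  moreover have "browder_path e - browder_path d = - b" by (simp add: b_def)
  ultimately have "inner ((e - d) *\<^sub>R a - d *\<^sub>R b) (- b) \<le> 0"
    using browder_path_two_parameters[of e d] assms by simp
  then have "d * (norm b)\<^sup>2 \<le> (e - d) * inner a b"
    by (simp add: inner_diff_left power2_norm_eq_inner)
  moreover have "0 \<le> d * (norm b)\<^sup>2" using assms by simp
  ultimately have "0 \<le> (e - d) * inner a b" by linarith
  then have "0 \<le> inner a b" using assms by (simp add: zero_le_mult_iff)
  then have "(norm a)\<^sup>2 + (norm b)\<^sup>2 \<le> (norm (browder_path d - y))\<^sup>2"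
    unfolding pd power2_norm_add_scaleR by simp
  then show ?thesis by (simp add: a_def b_def)
qed

text \<open>
  The squared norms \<open>h e\<close> are bounded with supremum \<open>L\<close>; once \<open>h e > L - r\<^sup>2\<close>, all later points are within
  \<open>r\<close> of \<open>z\<^sub>e\<close> by \<open>browder_path_gap\<close>.  In the limit \<open>e (z\<^sub>e - y)\<close> disappears, so the limit is a fixed point, and
  \<open>browder_path_variational\<close> passes to the limit.
\<close>
lemma browder_path_tendsto_proj:
  assumes nonempty: "{z \<in> D. T z = z} \<noteq> {}"
  shows "(browder_path \<longlongrightarrow> proj {z \<in> D. T z = z} y) (at_right 0)"
    and "proj {z \<in> D. T z = z} y \<in> D"
proof -
  obtain q0 where q0: "q0 \<in> D" "T q0 = q0" using nonempty by blast
  define M where "M = norm (q0 - y)"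
  have M: "norm (browder_path e - y) \<le> M" if "e > 0" for e
    unfolding M_def using browder_path_bounded[OF that q0] .
  define h where "h e = (norm (browder_path e - y))\<^sup>2" for e
  define L where "L = Sup (h ` {0<..})"
  have bdd: "bdd_above (h ` {0<..})"
    by (rule bdd_aboveI[of _ "M\<^sup>2"]) (auto simp: h_def intro!: power_mono M)
  have near: "\<exists>e>0. \<forall>d. 0 < d \<longrightarrow> d < e \<longrightarrow> dist (browder_path d) (browder_path e) < r" if "r > 0" for r
  proof -
    have "L - r\<^sup>2 < Sup (h ` {0<..})" using \<open>r > 0\<close> by (simp add: L_def)
    then obtain e where e: "e > 0" "L - r\<^sup>2 < h e"
      by (subst (asm) less_cSup_iff) (use bdd in auto)
    have "dist (browder_path d) (browder_path e) < r" if "0 < d" "d < e" for d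
    proof -
      have "h d \<le> L" unfolding L_def using that by (intro cSup_upper bdd) auto
      then have "(norm (browder_path d - browder_path e))\<^sup>2 < r\<^sup>2" using browder_path_gap[OF that] e(2) by (simp add: h_def)
      then show ?thesis using \<open>r > 0\<close> by (simp add: dist_norm power_less_imp_less_base)
    qed
    then show ?thesis using e by blast
  qed
  define s where "s n = browder_path (inverse (real (Suc n)))" for n
  have small: "\<forall>\<^sub>F n in sequentially. inverse (real (Suc n)) < e" if "e > 0" for e
    using LIMSEQ_inverse_real_of_nat that by (rule order_tendstoD)
  have "Cauchy s"
  proof (rule metric_CauchyI)
    fix r :: real assume "r > 0"
    then obtain e where e: "e > 0" "\<And>d. 0 < d \<Longrightarrow> d < e \<Longrightarrow> dist (browder_path d) (browder_path e) < r / 2"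
      using near[of "r / 2"] by auto
    obtain N where N: "\<And>n. n \<ge> N \<Longrightarrow> inverse (real (Suc n)) < e"
      using small[OF e(1)] by (auto simp: eventually_sequentially)
    show "\<exists>N. \<forall>m\<ge>N. \<forall>n\<ge>N. dist (s m) (s n) < r"
    proof (intro exI allI impI)
      have s_e: "dist (s n) (browder_path e) < r / 2" if "n \<ge> N" for n
        unfolding s_def by (rule e(2)) (use N[OF that] in simp_all)
      fix m n assume "m \<ge> N" "n \<ge> N"
      then show "dist (s m) (s n) < r" by (rule dist_triangle_half_l[OF s_e s_e])
    qed
  qed
  then obtain z where z: "s \<longlonglongrightarrow> z" using Cauchy_convergent_iff convergent_def by blast
  have lim: "(browder_path \<longlongrightarrow> z) (at_right 0)"
  proof (rule tendstoI)
    fix r :: real assume "r > 0"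
    then obtain e where e: "e > 0" "\<And>d. 0 < d \<Longrightarrow> d < e \<Longrightarrow> dist (browder_path d) (browder_path e) < r / 3"
      using near[of "r / 3"] by auto
    have "dist z (browder_path e) \<le> r / 3"
    proof (rule tendsto_upperbound)
      show "((\<lambda>n. dist (s n) (browder_path e)) \<longlongrightarrow> dist z (browder_path e)) sequentially" by (intro tendsto_intros z)
      show "\<forall>\<^sub>F n in sequentially. dist (s n) (browder_path e) \<le> r / 3"
        using small[OF e(1)]
      proof eventually_elim
        case (elim n)
        then show ?case using e(2)[of "inverse (real (Suc n))"] unfolding s_def by simp
      qed
    qed simp
    then have "dist (browder_path d) z < r" if "0 < d" "d < e" for d
      using e(2)[OF that] dist_triangle[of "browder_path d" z "browder_path e"] \<open>r > 0\<close> by (simp add: dist_commute)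
    then show "\<forall>\<^sub>F d in at_right 0. dist (browder_path d) z < r"
      using e(1) by (auto simp: eventually_at_right_field)
  qed
  have pos: "\<forall>\<^sub>F e in at_right (0::real). e > 0" by (simp add: eventually_at_right_less)
  have zD: "z \<in> D"
    by (rule Lim_in_closed_set[OF closed_D _ _ lim]) (use pos in \<open>auto elim!: eventually_mono simp: browder_path_in\<close>)
  have "norm (T z - z) \<le> 0"
  proof (rule tendsto_lowerbound)
    have "((\<lambda>e. 2 * norm (browder_path e - z) + e * M) \<longlongrightarrow> 2 * norm (z - z) + 0 * M) (at_right 0)"
      by (intro tendsto_intros lim)
    then show "((\<lambda>e. 2 * norm (browder_path e - z) + e * M) \<longlongrightarrow> 0) (at_right 0)" by simp
    show "\<forall>\<^sub>F e in at_right 0. norm (T z - z) \<le> 2 * norm (browder_path e - z) + e * M"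
      using pos
    proof eventually_elim
      case (elim e)
      have "T z - z = (T z - T (browder_path e)) + (T (browder_path e) - browder_path e) + (browder_path e - z)" by simp
      then have "norm (T z - z) \<le> norm (T z - T (browder_path e)) + norm (T (browder_path e) - browder_path e) + norm (browder_path e - z)"
        by (metis (no_types) order_trans[OF norm_triangle_ineq add_right_mono[OF norm_triangle_ineq]])
      moreover have "norm (T z - T (browder_path e)) \<le> norm (browder_path e - z)"
        using T_nonexpansive[OF zD browder_path_in[OF elim]] by (simp add: norm_minus_commute)
      moreover have "norm (T (browder_path e) - browder_path e) \<le> e * M"
        using elim M[OF elim] by (simp add: browder_path_eq)
      ultimately show ?case by simp
    qed
  qed simp
  then have zT: "T z = z" by simp
  have "inner (z - y) (z - q) \<le> 0" if "q \<in> {z \<in> D. T z = z}" for q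
  proof (rule tendsto_upperbound)
    show "((\<lambda>e. inner (browder_path e - y) (browder_path e - q)) \<longlongrightarrow> inner (z - y) (z - q)) (at_right 0)"
      by (intro tendsto_intros lim)
    show "\<forall>\<^sub>F e in at_right 0. inner (browder_path e - y) (browder_path e - q) \<le> 0"
      using pos that by (auto elim!: eventually_mono intro!: browder_path_variational)
  qed simp
  then have "proj {z \<in> D. T z = z} y = z" using zD zT by (intro proj_eqI) auto
  then show "(browder_path \<longlongrightarrow> proj {z \<in> D. T z = z} y) (at_right 0)" "proj {z \<in> D. T z = z} y \<in> D"
    using lim zD by auto
qed

text \<open>The path extends continuously to \<open>0\<close> by its limit, so the set is the image of a compact interval.\<close>
lemma compact_browder_path:
  assumes nonempty: "{z \<in> D. T z = z} \<noteq> {}" and "e0 > 0"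
  shows "compact (insert (proj {z \<in> D. T z = z} y) (browder_path ` {0<..e0}))" (is "compact (insert ?p _)")
proof -
  obtain q where q: "q \<in> D" "T q = q" using nonempty by blast
  define g where "g e = (if e = 0 then ?p else browder_path e)" for e
  have "continuous_on {0..e0} g"
    unfolding continuous_on_def
  proof
    fix d assume d: "d \<in> {0..e0}"
    show "(g \<longlongrightarrow> g d) (at d within {0..e0})"
    proof (cases "d = 0")
      case True
      have "(g \<longlongrightarrow> ?p) (at_right 0)"
        using browder_path_tendsto_proj(1)[OF nonempty]
        by (rule Lim_transform_eventually) (auto simp: g_def eventually_at_filter)
      moreover have "at 0 within {0..e0} = at_right 0"
        using \<open>e0 > 0\<close> by (simp add: at_within_Icc_at_right)
      ultimately show ?thesis using True by (simp add: g_def)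
    next
      case False
      with d have "d > 0" by simp
      have pos: "\<forall>\<^sub>F e in at d within {0..e0}. e > 0"
        using tendsto_ident_at \<open>d > 0\<close> by (rule order_tendstoD)
      have "((\<lambda>e. browder_path e - browder_path d) \<longlongrightarrow> 0) (at d within {0..e0})"
      proof (rule tendsto_0_le)
        show "((\<lambda>e. e - d) \<longlongrightarrow> 0) (at d within {0..e0})"
          by (rule LIM_zero) (rule tendsto_ident_at)
        show "\<forall>\<^sub>F e in at d within {0..e0}.
            norm (browder_path e - browder_path d) \<le> norm (e - d) * (norm (q - y) / d)"
          using pos
        proof eventually_elim
          case (elim e)
          have "d * norm (browder_path d - browder_path e) \<le> \<bar>d - e\<bar> * norm (browder_path e - y)"
            using \<open>d > 0\<close> elim by (rule browder_path_lipschitz)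
          also have "\<dots> \<le> \<bar>d - e\<bar> * norm (q - y)"
            using browder_path_bounded[OF elim q] by (rule mult_left_mono) simp
          finally show ?case
            using \<open>d > 0\<close> by (simp add: field_simps norm_minus_commute abs_minus_commute)
        qed
      qed
      then have "(browder_path \<longlongrightarrow> browder_path d) (at d within {0..e0})" by (rule LIM_zero_cancel)
      moreover have "\<forall>\<^sub>F e in at d within {0..e0}. browder_path e = g e"
        by (rule eventually_mono[OF pos]) (simp add: g_def)
      ultimately have "(g \<longlongrightarrow> browder_path d) (at d within {0..e0})"
        by (rule Lim_transform_eventually)
      then show ?thesis using \<open>d > 0\<close> by (simp add: g_def)
    qed
  qed
  then have "compact (g ` {0..e0})" by (intro compact_continuous_image compact_Icc)
  moreover have "g ` {0..e0} = insert ?p (browder_path ` {0<..e0})"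
  proof -
    have "{0..e0} = insert 0 {0<..e0}" using \<open>e0 > 0\<close> by auto
    moreover have "g ` {0<..e0} = browder_path ` {0<..e0}" by (intro image_cong) (auto simp: g_def)
    moreover have "g 0 = ?p" by (simp add: g_def)
    ultimately show ?thesis by (simp only: image_insert)
  qed
  ultimately show ?thesis by simp
qed

end

section \<open>Trajectories follow the regularised fixed points\<close>

text \<open>
  The vector field \<open>n1 + n2 - (1 + e) w\<close> is the one of \<open>w = x - \<xi>\<close>: \<open>n1\<close> is a difference of values of a
  nonexpansive map and \<open>n2\<close> a perturbation.  In \<open>w + h (n1 + n2 - (1 + e) w)\<close> the factor \<open>1 - h (1 + e)\<close> of \<open>w\<close>
  loses \<open>h (1 + e) \<parallel>w\<parallel>\<close>, of which \<open>n1\<close> can restore at most \<open>h \<parallel>w\<parallel>\<close>.  Negative steps \<open>h\<close> are included, as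
  slopes from both sides are needed; the restriction on \<open>\<bar>h\<bar>\<close> keeps the factor nonnegative.
\<close>
lemma norm_forward_slope:
  fixes w :: "'a::real_normed_vector"
  assumes "norm n1 \<le> norm w" "norm n2 \<le> \<rho>" and "h \<noteq> 0" "\<bar>h\<bar> * (1 + e) \<le> 1" "e \<ge> 0"
  shows "(norm (w + h *\<^sub>R (n1 + n2 - (1 + e) *\<^sub>R w)) - norm w) / h \<le> \<rho> - e * norm w"
proof -
  have eq: "w + h *\<^sub>R (n1 + n2 - (1 + e) *\<^sub>R w) = (1 - h * (1 + e)) *\<^sub>R w + h *\<^sub>R (n1 + n2)"
    by (simp add: algebra_simps)
  have n: "norm (h *\<^sub>R (n1 + n2)) \<le> \<bar>h\<bar> * (norm w + \<rho>)"
    using assms(1,2) by (auto intro!: mult_left_mono norm_triangle_le)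
  have 1: "norm ((1 - h * (1 + e)) *\<^sub>R w) = (1 - h * (1 + e)) * norm w"
  proof -
    have "h * (1 + e) \<le> \<bar>h\<bar> * (1 + e)" using \<open>e \<ge> 0\<close> by (intro mult_right_mono) auto
    then show ?thesis using assms(4) by simp
  qed
  show ?thesis
  proof (cases "h > 0")
    case True
    have "norm (w + h *\<^sub>R (n1 + n2 - (1 + e) *\<^sub>R w)) \<le> (1 - h * (1 + e)) * norm w + h * (norm w + \<rho>)"
      unfolding eq
    proof (rule order_trans[OF norm_triangle_ineq], rule add_mono)
      show "norm (h *\<^sub>R (n1 + n2)) \<le> h * (norm w + \<rho>)" using n True by (simp only: abs_of_pos)
    qed (simp only: 1)
    then have "norm (w + h *\<^sub>R (n1 + n2 - (1 + e) *\<^sub>R w)) - norm w \<le> (\<rho> - e * norm w) * h"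
      by (simp add: algebra_simps)
    then show ?thesis using True by (simp add: pos_divide_le_eq)
  next
    case False
    then have h: "h < 0" using assms by simp
    have "(1 - h * (1 + e)) * norm w - (- h) * (norm w + \<rho>) \<le> norm (w + h *\<^sub>R (n1 + n2 - (1 + e) *\<^sub>R w))"
      unfolding eq
    proof (rule order_trans[OF diff_mono norm_diff_ineq])
      show "norm (h *\<^sub>R (n1 + n2)) \<le> (- h) * (norm w + \<rho>)" using n h by (simp only: abs_of_neg)
    qed (simp only: 1)
    then have "(\<rho> - e * norm w) * h \<le> norm (w + h *\<^sub>R (n1 + n2 - (1 + e) *\<^sub>R w)) - norm w"
      by (simp add: algebra_simps)
    then show ?thesis using h by (simp add: neg_divide_le_eq)
  qed
qed

text \<open>Since \<open>x\<close> is differentiable at \<open>t\<close>, the previous lemma applies up to \<open>o(h)\<close>.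
  The comparison curve \<open>\<xi>\<close> enters through a Lipschitz bound at \<open>t\<close>, which costs the additive constant \<open>c\<close>.\<close>
lemma norm_diff_upper_slope:
  fixes x \<xi> :: "real \<Rightarrow> 'a::real_normed_vector"
  assumes x: "(x has_vector_derivative n1 + n2 - (1 + e) *\<^sub>R (x t - \<xi> t)) (at t)"
    and n: "norm n1 \<le> norm (x t - \<xi> t)" "norm n2 \<le> \<rho>" and "e \<ge> 0"
    and \<xi>: "\<forall>\<^sub>F v in at t. norm (\<xi> v - \<xi> t) \<le> c * \<bar>v - t\<bar>" and "\<eta> > 0"
  shows "\<forall>\<^sub>F v in at t. (norm (x v - \<xi> v) - norm (x t - \<xi> t)) / (v - t)
    < \<rho> + c - e * norm (x t - \<xi> t) + \<eta>"
proof -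
  define w where "w = x t - \<xi> t"
  define d where "d = n1 + n2 - (1 + e) *\<^sub>R w"
  have "((\<lambda>v. norm (x v - x t - (v - t) *\<^sub>R d) / norm (v - t)) \<longlongrightarrow> 0) (at t)"
    using x unfolding has_vector_derivative_def has_derivative_iff_norm d_def w_def by simp
  then have ev1: "\<forall>\<^sub>F v in at t. norm (x v - x t - (v - t) *\<^sub>R d) / norm (v - t) < \<eta>"
    using \<open>\<eta> > 0\<close> by (rule order_tendstoD)
  have "1 / (1 + e) > 0" using \<open>e \<ge> 0\<close> by simp
  then have ev2: "\<forall>\<^sub>F v in at t. v \<noteq> t \<and> \<bar>v - t\<bar> < 1 / (1 + e)"
    unfolding eventually_at by (intro exI[of _ "1 / (1 + e)"]) (auto simp: dist_real_def)
  show ?thesis using ev1 ev2 \<xi>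
  proof eventually_elim
    case (elim v)
    define h where "h = v - t"
    have h: "h \<noteq> 0" "\<bar>h\<bar> * (1 + e) \<le> 1" "\<bar>h\<bar> > 0"
      using elim(2) \<open>e \<ge> 0\<close> by (auto simp: h_def field_simps)
    define rem where "rem = (x v - x t - h *\<^sub>R d) + (\<xi> t - \<xi> v)"
    have rem: "norm rem < \<bar>h\<bar> * (\<eta> + c)"
    proof -
      have "norm (x v - x t - h *\<^sub>R d) < \<eta> * \<bar>h\<bar>"
        using elim(1) h(3) by (simp add: h_def[symmetric] pos_divide_less_eq)
      moreover have "norm (\<xi> t - \<xi> v) \<le> c * \<bar>h\<bar>"
        using elim(3) by (simp add: h_def norm_minus_commute)
      moreover have "norm rem \<le> norm (x v - x t - h *\<^sub>R d) + norm (\<xi> t - \<xi> v)"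
        unfolding rem_def by (rule norm_triangle_ineq)
      ultimately show ?thesis by (simp add: algebra_simps)
    qed
    have eq: "x v - \<xi> v = (w + h *\<^sub>R d) + rem" by (simp add: rem_def w_def)
    have "\<bar>norm (x v - \<xi> v) - norm (w + h *\<^sub>R d)\<bar> \<le> norm rem"
      unfolding eq using norm_triangle_ineq3[of "(w + h *\<^sub>R d) + rem" "w + h *\<^sub>R d"] by simp
    then have "(norm (x v - \<xi> v) - norm (w + h *\<^sub>R d)) / h < \<eta> + c"
      using rem h(3) by (cases "h > 0") (auto simp: divide_less_eq abs_le_iff algebra_simps)
    moreover have "(norm (w + h *\<^sub>R d) - norm w) / h \<le> \<rho> - e * norm w"
      unfolding d_def using n h \<open>e \<ge> 0\<close> by (intro norm_forward_slope) (auto simp: w_def)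
    moreover have "(norm (x v - \<xi> v) - norm w) / h = (norm (x v - \<xi> v) - norm (w + h *\<^sub>R d)) / h
        + (norm (w + h *\<^sub>R d) - norm w) / h"
      by (simp add: diff_divide_distrib)
    ultimately show ?case unfolding w_def[symmetric] h_def[symmetric] by linarith
  qed
qed

context anchored_nonexpansive
begin

text \<open>
  The constant \<open>c\<close> is chosen such that the movement of \<open>\<xi>\<close> costs at most \<open>r \<epsilon> / 4\<close>, and the perturbation
  eventually costs at most as much.  Where \<open>\<parallel>x - \<xi>\<parallel> > r\<close>, the contraction term \<open>\<epsilon> \<parallel>x - \<xi>\<parallel>\<close> leaves
  a decay rate of \<open>r \<epsilon> / 2\<close>.
\<close>
lemma tracks_browder_path:
  fixes x :: "real \<Rightarrow> 'a" and Tt :: "real \<Rightarrow> 'a \<Rightarrow> 'a"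
  assumes fixed: "q \<in> D" "T q = q"
    and eps_pos: "\<And>t. t \<ge> 0 \<Longrightarrow> \<epsilon> t > 0"
    and eps_ac: "abs_continuous_on {0..} \<epsilon>"
    and eps_noninc: "antimono_on {0..} \<epsilon>"
    and eps_int: "(\<integral>\<^sup>+ s\<in>{0..}. ennreal (\<epsilon> s) \<partial>lebesgue) = \<infinity>"
    and eps_deriv: "ess_tendsto_at_top (\<lambda>t. deriv \<epsilon> t / (\<epsilon> t)\<^sup>2) 0"
    and Tt: "\<And>t z w. t \<ge> 0 \<Longrightarrow> z \<in> D \<Longrightarrow> w \<in> D \<Longrightarrow> norm (Tt t z - Tt t w) \<le> norm (z - w)"
    and pert: "((\<lambda>t. norm (Tt t (browder_path (\<epsilon> t)) - T (browder_path (\<epsilon> t))) / \<epsilon> t) \<longlongrightarrow> 0) at_top"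
    and sol: "is_solution D (\<lambda>t z. - (z - Tt t z + \<epsilon> t *\<^sub>R (z - y))) x0 x"
  shows "((\<lambda>t. x t - browder_path (\<epsilon> t)) \<longlongrightarrow> 0) at_top"
proof -
  define M where "M = norm (q - y) + 1"
  define \<xi> where "\<xi> t = browder_path (\<epsilon> t)" for t
  define \<rho> where "\<rho> t = norm (Tt t (\<xi> t) - T (\<xi> t))" for t
  define u where "u t = norm (x t - \<xi> t)" for t
  have anti: "\<epsilon> t \<le> \<epsilon> s" if "0 \<le> s" "s \<le> t" for s t
    using eps_noninc that by (auto simp: monotone_on_def)
  have M: "M > 0" "norm (\<xi> t - y) \<le> M" if "t \<ge> 0" for t
    using browder_path_bounded[OF eps_pos[OF that] fixed] norm_ge_zero[of "q - y"]
    unfolding M_def \<xi>_def by linarith+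
  have \<xi>D: "\<xi> t \<in> D" if "t \<ge> 0" for t unfolding \<xi>_def using browder_path_in eps_pos that by blast
  obtain E where E: "\<And>t. t > 0 \<Longrightarrow> (E has_real_derivative \<epsilon> t) (at t)" "filterlim E at_top at_top"
  proof (rule antiderivative_at_top)
    show "continuous_on {0..} \<epsilon>" using eps_ac by (rule abs_continuous_on_imp_continuous_on)
  qed (use eps_pos eps_int in \<open>auto intro: less_imp_le\<close>)
  have x: "abs_continuous_on {0..b} x" "x t \<in> D" if "b \<ge> 0" "t \<ge> 0" for b t
    using sol that by (auto simp: is_solution_def loc_abs_continuous_def)
  have "\<forall>\<^sub>F t in at_top. u t \<le> r" if "r > 0" for r
  proof -
    define c where "c = r / (4 * M)"
    have c: "c > 0" using \<open>r > 0\<close> M(1)[of 0] by (simp add: c_def)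
    obtain T1 where T1: "T1 \<ge> 0"
      "\<And>s t. T1 \<le> s \<Longrightarrow> s \<le> t \<Longrightarrow> 1 / \<epsilon> t - 1 / \<epsilon> s \<le> c * (t - s)"
      using reciprocal_slope_small[OF eps_pos eps_ac eps_noninc eps_deriv c] by metis
    have "\<forall>\<^sub>F t in at_top. \<rho> t / \<epsilon> t < r / 4"
      using pert \<open>r > 0\<close> unfolding \<rho>_def \<xi>_def by (intro order_tendstoD) auto
    then obtain T2 where T2: "\<And>t. t \<ge> T2 \<Longrightarrow> \<rho> t / \<epsilon> t < r / 4"
      by (auto simp: eventually_at_top_linorder)
    define T0 where "T0 = max 1 (max T1 T2)"
    have T0: "T0 \<ge> 1" "T0 \<ge> T1" "T0 \<ge> T2" by (auto simp: T0_def)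
    have eps_diff: "\<epsilon> s - \<epsilon> t \<le> c * \<epsilon> s * \<epsilon> t * (t - s)" if st: "T0 \<le> s" "s \<le> t" for s t
    proof -
      have p: "\<epsilon> s > 0" "\<epsilon> t > 0" using st T0 by (auto intro!: eps_pos)
      have "\<epsilon> s - \<epsilon> t = (\<epsilon> s * \<epsilon> t) * (1 / \<epsilon> t - 1 / \<epsilon> s)" using p by (simp add: field_simps)
      also have "\<dots> \<le> (\<epsilon> s * \<epsilon> t) * (c * (t - s))" using p st T0 by (intro mult_left_mono T1) auto
      finally show ?thesis by (simp add: mult_ac)
    qed
    \<comment> \<open>\<open>browder_path_lipschitz\<close> loses a factor \<open>1 / \<epsilon> v\<close>, which the bound for \<open>1 / \<epsilon>\<close> compensates.\<close>
    have \<xi>_lip: "norm (\<xi> v - \<xi> t) \<le> c * M * \<epsilon> t * \<bar>v - t\<bar>" if vt: "T0 \<le> v" "T0 \<le> t" for v t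
    proof -
      have p: "\<epsilon> v > 0" "\<epsilon> t > 0" using vt T0 by (auto intro!: eps_pos)
      have "\<bar>\<epsilon> v - \<epsilon> t\<bar> \<le> c * \<epsilon> v * \<epsilon> t * \<bar>v - t\<bar>"
        using eps_diff[of v t] eps_diff[of t v] anti[of v t] anti[of t v] vt T0
        by (cases "v \<le> t") (simp_all add: mult_ac)
      then have "\<bar>\<epsilon> v - \<epsilon> t\<bar> * norm (\<xi> t - y) \<le> (c * \<epsilon> v * \<epsilon> t * \<bar>v - t\<bar>) * M"
        using M vt T0 c p by (intro mult_mono) auto
      then have "\<epsilon> v * norm (\<xi> v - \<xi> t) \<le> \<epsilon> v * (c * M * \<epsilon> t * \<bar>v - t\<bar>)"
        using browder_path_lipschitz[OF p] unfolding \<xi>_def by (simp add: mult_ac)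
      then show ?thesis using p by simp
    qed
    show "\<forall>\<^sub>F t in at_top. u t \<le> r"
    proof (rule eventually_le_of_decay[where T = "T0 + 1" and c = "r / 2" and E = E and \<epsilon> = \<epsilon> and L = "\<epsilon> 0"])
      fix a b assume ab: "T0 + 1 \<le> a" "a \<le> b"
      have "abs_continuous_on {a..b} x"
        using ab T0 by (intro abs_continuous_on_subset[OF x(1)[of b 0]]) auto
      then show "abs_continuous_on {a..b} u"
      proof (rule abs_continuous_on_dominated)
        fix s t assume st: "s \<in> {a..b}" "t \<in> {a..b}" "s \<le> t"
        have "norm (\<xi> t - \<xi> s) \<le> c * M * \<epsilon> s * \<bar>t - s\<bar>" using st ab by (intro \<xi>_lip) auto
        also have "\<dots> \<le> c * M * \<epsilon> 0 * \<bar>t - s\<bar>"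
          using st ab T0 c M(1)[of 0] by (intro mult_right_mono mult_left_mono anti) auto
        finally have "norm (\<xi> t - \<xi> s) \<le> c * M * \<epsilon> 0 * (t - s)" using st by simp
        moreover have "\<bar>u t - u s\<bar> \<le> norm ((x t - \<xi> t) - (x s - \<xi> s))"
          unfolding u_def by (rule norm_triangle_ineq3)
        moreover have "(x t - \<xi> t) - (x s - \<xi> s) = (x t - x s) - (\<xi> t - \<xi> s)" by simp
        then have "norm ((x t - \<xi> t) - (x s - \<xi> s)) \<le> norm (x t - x s) + norm (\<xi> t - \<xi> s)"
          using norm_triangle_ineq4 by metis
        ultimately show "norm (u t - u s) \<le> 1 * norm (x t - x s) + c * M * \<epsilon> 0 * (t - s)" by simp
      qed
    next
      have "AE t in lebesgue. t \<ge> 0 \<longrightarrow>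
          (x has_vector_derivative - (x t - Tt t (x t) + \<epsilon> t *\<^sub>R (x t - y))) (at t)"
        using sol by (simp add: is_solution_def)
      then show "AE t in lebesgue. T0 + 1 < t \<longrightarrow> r < u t \<longrightarrow>
        (\<forall>e>0. \<forall>\<^sub>F v in at t. (u v - u t) / (v - t) < - (r / 2) * \<epsilon> t + e)"
      proof eventually_elim
        case (elim t)
        show ?case
        proof (intro impI allI)
          fix e :: real assume t: "T0 + 1 < t" "r < u t" and "e > 0"
          have t0: "t \<ge> 0" "\<epsilon> t > 0" using t T0 by (auto intro!: eps_pos)
          define n1 n2 where "n1 = Tt t (x t) - Tt t (\<xi> t)" and "n2 = Tt t (\<xi> t) - T (\<xi> t)"
          have "T (\<xi> t) = \<xi> t + \<epsilon> t *\<^sub>R (\<xi> t - y)"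
            using browder_path_eq[OF t0(2)] by (simp add: \<xi>_def algebra_simps)
          then have "- (x t - Tt t (x t) + \<epsilon> t *\<^sub>R (x t - y)) = n1 + n2 - (1 + \<epsilon> t) *\<^sub>R (x t - \<xi> t)"
            by (simp add: n1_def n2_def algebra_simps)
          then have "(x has_vector_derivative n1 + n2 - (1 + \<epsilon> t) *\<^sub>R (x t - \<xi> t)) (at t)"
            using elim t0 by simp
          moreover have "norm n1 \<le> norm (x t - \<xi> t)"
            unfolding n1_def using t0 x(2)[OF t0(1) t0(1)] \<xi>D by (intro Tt) auto
          moreover have "norm n2 \<le> \<rho> t" by (simp add: n2_def \<rho>_def)
          moreover have "\<forall>\<^sub>F v in at t. norm (\<xi> v - \<xi> t) \<le> c * M * \<epsilon> t * \<bar>v - t\<bar>"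
          proof -
            have "\<forall>\<^sub>F v in at t. v \<in> {T0<..}"
              using t by (intro eventually_at_in_open') auto
            then show ?thesis by (rule eventually_mono) (use t in \<open>auto intro!: \<xi>_lip\<close>)
          qed
          ultimately have "\<forall>\<^sub>F v in at t. (u v - u t) / (v - t)
              < \<rho> t + c * M * \<epsilon> t - \<epsilon> t * u t + e"
            unfolding u_def using t0 \<open>e > 0\<close> by (intro norm_diff_upper_slope) auto
          moreover have "\<rho> t + c * M * \<epsilon> t - \<epsilon> t * u t \<le> - (r / 2) * \<epsilon> t"
          proof -
            have "\<rho> t < r * \<epsilon> t / 4" using T2[of t] t T0 t0 by (simp add: pos_divide_less_eq)
            moreover have "c * M = r / 4" using M(1)[of 0] by (simp add: c_def)
            then have "c * M * \<epsilon> t = r * \<epsilon> t / 4" by simp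
            moreover have "r * \<epsilon> t \<le> \<epsilon> t * u t" using t t0 by (simp add: mult.commute)
            moreover have "- (r / 2) * \<epsilon> t = - (r * \<epsilon> t / 2)" by simp
            ultimately show ?thesis by argo
          qed
          ultimately show "\<forall>\<^sub>F v in at t. (u v - u t) / (v - t) < - (r / 2) * \<epsilon> t + e"
            by (auto elim!: eventually_mono)
        qed
      qed
    next
      show "\<epsilon> t \<le> \<epsilon> 0" "0 \<le> \<epsilon> t" if "t \<ge> T0 + 1" for t
        using that T0 anti[of 0 t] eps_pos[of t] by auto
    qed (use E T0 \<open>r > 0\<close> in \<open>auto simp: u_def\<close>)
  qed
  then have "(u \<longlongrightarrow> 0) at_top"
  proof (intro tendstoI)
    fix r :: real assume "r > 0" and ev: "\<And>r. r > 0 \<Longrightarrow> \<forall>\<^sub>F t in at_top. u t \<le> r"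
    show "\<forall>\<^sub>F t in at_top. dist (u t) 0 < r"
      using ev[of "r / 2"] \<open>r > 0\<close> by (auto elim!: eventually_mono simp: u_def)
  qed
  then show ?thesis unfolding u_def \<xi>_def by (simp add: tendsto_norm_zero_iff)
qed

end

section \<open>The forward-backward operator\<close>

text \<open>Expanding \<open>\<parallel>d - \<mu> b\<parallel>\<^sup>2\<close>, cocoercivity makes the mixed term outweigh \<open>\<mu>\<^sup>2 \<parallel>b\<parallel>\<^sup>2\<close> as long as
  \<open>\<mu> \<le> 2 \<beta>\<close>.\<close>
lemma forward_step_nonexpansive:
  assumes "cocoercive_on D \<beta> B" "0 < \<mu>" "\<mu> \<le> 2 * \<beta>" "x \<in> D" "y \<in> D"
  shows "norm ((x - \<mu> *\<^sub>R B x) - (y - \<mu> *\<^sub>R B y)) \<le> norm (x - y)"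
proof -
  define d b where "d = x - y" and "b = B x - B y"
  have "\<beta> * (norm b)\<^sup>2 \<le> inner b d" using assms by (simp add: cocoercive_on_def d_def b_def)
  then have "2 * \<mu> * (\<beta> * (norm b)\<^sup>2) \<le> 2 * \<mu> * inner d b"
    using \<open>0 < \<mu>\<close> by (simp add: inner_commute)
  moreover have "\<mu> * (\<mu> * (norm b)\<^sup>2) \<le> \<mu> * (2 * \<beta> * (norm b)\<^sup>2)"
    using assms by (intro mult_left_mono mult_right_mono) auto
  moreover have "(norm (d + (- \<mu>) *\<^sub>R b))\<^sup>2 = (norm d)\<^sup>2 + 2 * (- \<mu>) * inner d b + (- \<mu>)\<^sup>2 * (norm b)\<^sup>2"
    by (rule power2_norm_add_scaleR)
  ultimately have "(norm (d + (- \<mu>) *\<^sub>R b))\<^sup>2 \<le> (norm d)\<^sup>2"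
    by (simp add: power2_eq_square mult.assoc mult.left_commute)
  then have "norm (d + (- \<mu>) *\<^sub>R b) \<le> norm d" by (rule power2_le_imp_le) simp
  moreover have "d + (- \<mu>) *\<^sub>R b = (x - \<mu> *\<^sub>R B x) - (y - \<mu> *\<^sub>R B y)"
    by (simp add: d_def b_def algebra_simps)
  ultimately show ?thesis by (metis d_def)
qed

lemma cocoercive_on_lipschitz:
  assumes "cocoercive_on D \<beta> B" "\<beta> > 0" "x \<in> D" "y \<in> D"
  shows "norm (B x - B y) \<le> (1 / \<beta>) * norm (x - y)"
proof -
  have "\<beta> * (norm (B x - B y))\<^sup>2 \<le> inner (B x - B y) (x - y)"
    using assms by (simp add: cocoercive_on_def)
  also have "\<dots> \<le> norm (B x - B y) * norm (x - y)" by (rule norm_cauchy_schwarz)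
  finally have "norm (B x - B y) * (\<beta> * norm (B x - B y)) \<le> norm (B x - B y) * norm (x - y)"
    by (simp add: power2_eq_square mult.left_commute)
  then have "\<beta> * norm (B x - B y) \<le> norm (x - y)"
    by (cases "norm (B x - B y) = 0") (simp, metis mult_left_le_imp_le norm_ge_zero order_le_less)
  then show ?thesis using \<open>\<beta> > 0\<close> by (simp add: field_simps)
qed

lemma cocoercive_on_continuous:
  assumes "cocoercive_on D \<beta> B" "\<beta> > 0"
  shows "continuous_on D B"
  using cocoercive_on_lipschitz[OF assms] \<open>\<beta> > 0\<close>
  by (intro lipschitz_on_continuous_on[of "1 / \<beta>"] lipschitz_onI) (auto simp: dist_norm)

lemma zer_sum_eq_fixed_points:
  fixes \<Phi> :: "'a::{real_inner, complete_space} \<Rightarrow> ereal"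
  assumes \<Phi>: "proper_convex_lsc \<Phi>" and "\<mu> > 0"
  shows "zer_sum D \<Phi> B = {z \<in> D. prox \<mu> \<Phi> (z - \<mu> *\<^sub>R B z) = z}"
proof -
  have "(1 / \<mu>) *\<^sub>R (z - \<mu> *\<^sub>R B z - z) = - B z" for z using \<open>\<mu> > 0\<close> by simp
  then have "prox \<mu> \<Phi> (z - \<mu> *\<^sub>R B z) = z \<longleftrightarrow> - B z \<in> subdifferential \<Phi> z" for z
    using prox_eq_iff[OF assms, of "z - \<mu> *\<^sub>R B z" z] by simp
  moreover have "0 \<in> {v + B z | v. v \<in> subdifferential \<Phi> z} \<longleftrightarrow> - B z \<in> subdifferential \<Phi> z" for z
    by (auto simp: eq_neg_iff_add_eq_0[symmetric]) 
  ultimately show ?thesis by (simp add: zer_sum_def)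
qed

lemma anchored_nonexpansive_forward_backward:
  fixes \<Phi> :: "'a::{real_inner, complete_space} \<Rightarrow> ereal"
  assumes "proper_convex_lsc \<Phi>" "0 < \<mu>" "\<mu> < 2 * \<beta>" "cocoercive_on D \<beta> B"
    "closed D" "convex D" "closure (effective_domain \<Phi>) \<subseteq> D" "y \<in> D"
  shows "anchored_nonexpansive D (\<lambda>z. prox \<mu> \<Phi> (z - \<mu> *\<^sub>R B z)) y"
proof
  show "prox \<mu> \<Phi> (z - \<mu> *\<^sub>R B z) \<in> D" for z
    using prox_in_effective_domain[OF assms(1,2)] closure_subset assms(7) by blast
  show "norm (prox \<mu> \<Phi> (z - \<mu> *\<^sub>R B z) - prox \<mu> \<Phi> (w - \<mu> *\<^sub>R B w)) \<le> norm (z - w)"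
    if "z \<in> D" "w \<in> D" for z w
    using prox_nonexpansive[OF assms(1,2)] forward_step_nonexpansive[OF assms(4,2) _ that] assms(3)
    by (meson less_imp_le order_trans)
qed (use assms in auto)

text \<open>
  Change \<open>Bt\<close> to \<open>B\<close> first, inside the nonexpansive map \<open>prox \<mu> (\<Phi>t t)\<close>, and then \<open>\<Phi>t\<close> to \<open>\<Phi>\<close>.
  Compactness of \<open>K\<close> bounds the arguments of \<open>prox\<close> and makes the supremum over \<open>K\<close> an upper bound
  (a supremum of an unbounded set of reals would say nothing).
\<close>
lemma forward_backward_perturbation:
  fixes \<Phi> :: "'a::{real_inner, complete_space} \<Rightarrow> ereal"
    and \<Phi>t :: "real \<Rightarrow> 'a \<Rightarrow> ereal"
  assumes \<Phi>t: "\<And>t. t \<ge> 0 \<Longrightarrow> proper_convex_lsc (\<Phi>t t)"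
    and B: "continuous_on K B" "\<And>t. t \<ge> 0 \<Longrightarrow> continuous_on K (Bt t)"
    and K: "compact K" "\<And>t. t \<ge> 0 \<Longrightarrow> \<xi> t \<in> K"
    and "0 < \<mu>" and eps_pos: "\<And>t. t \<ge> 0 \<Longrightarrow> \<epsilon> t > 0" and kappa: "\<And>t. t \<ge> 0 \<Longrightarrow> \<kappa> t \<ge> 0"
    and "c > 0" "p > 0"
    and prox_close: "\<And>t z. t \<ge> 0 \<Longrightarrow>
      norm (prox \<mu> (\<Phi>t t) z - prox \<mu> \<Phi> z) \<le> \<kappa> t * (norm z + c) powr p"
    and kappa_lim: "((\<lambda>t. \<kappa> t / \<epsilon> t) \<longlongrightarrow> 0) at_top"
    and B_close: "((\<lambda>t. 1 / \<epsilon> t * (SUP z\<in>K. norm (Bt t z - B z))) \<longlongrightarrow> 0) at_top"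
  shows "((\<lambda>t. norm (prox \<mu> (\<Phi>t t) (\<xi> t - \<mu> *\<^sub>R Bt t (\<xi> t)) - prox \<mu> \<Phi> (\<xi> t - \<mu> *\<^sub>R B (\<xi> t))) / \<epsilon> t)
    \<longlongrightarrow> 0) at_top"
proof -
  have "compact ((\<lambda>z. z - \<mu> *\<^sub>R B z) ` K)"
    using K B(1) by (intro compact_continuous_image continuous_intros)
  then have "bounded ((\<lambda>z. z - \<mu> *\<^sub>R B z) ` K)" by (rule compact_imp_bounded)
  then obtain R where R: "\<And>z. z \<in> K \<Longrightarrow> norm (z - \<mu> *\<^sub>R B z) \<le> R"
    by (auto simp: bounded_iff)
  define S where "S t = (SUP z\<in>K. norm (Bt t z - B z))" for t
  have S: "norm (Bt t z - B z) \<le> S t" if "t \<ge> 0" "z \<in> K" for t z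
  proof -
    have "compact ((\<lambda>z. norm (Bt t z - B z)) ` K)"
      using K B that by (intro compact_continuous_image continuous_intros)
    then have "bdd_above ((\<lambda>z. norm (Bt t z - B z)) ` K)"
      by (intro bounded_imp_bdd_above compact_imp_bounded)
    then show ?thesis unfolding S_def using that by (intro cSUP_upper)
  qed
  show ?thesis
  proof (rule tendsto_sandwich[OF _ _ tendsto_const])
    have "((\<lambda>t. \<mu> * (1 / \<epsilon> t * S t) + (R + c) powr p * (\<kappa> t / \<epsilon> t)) \<longlongrightarrow> \<mu> * 0 + (R + c) powr p * 0) at_top"
      using kappa_lim B_close unfolding S_def by (intro tendsto_intros)
    then show "((\<lambda>t. \<mu> * (1 / \<epsilon> t * S t) + (R + c) powr p * (\<kappa> t / \<epsilon> t)) \<longlongrightarrow> 0) at_top" by simp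
    show "\<forall>\<^sub>F t in at_top. 0 \<le> norm (prox \<mu> (\<Phi>t t) (\<xi> t - \<mu> *\<^sub>R Bt t (\<xi> t)) - prox \<mu> \<Phi> (\<xi> t - \<mu> *\<^sub>R B (\<xi> t))) / \<epsilon> t"
      using eventually_ge_at_top[of 0] by eventually_elim (simp add: eps_pos less_imp_le)
    show "\<forall>\<^sub>F t in at_top. norm (prox \<mu> (\<Phi>t t) (\<xi> t - \<mu> *\<^sub>R Bt t (\<xi> t)) - prox \<mu> \<Phi> (\<xi> t - \<mu> *\<^sub>R B (\<xi> t))) / \<epsilon> t
        \<le> \<mu> * (1 / \<epsilon> t * S t) + (R + c) powr p * (\<kappa> t / \<epsilon> t)"
      using eventually_ge_at_top[of 0]
    proof eventually_elim
      case (elim t)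
      define z where "z = \<xi> t"
      have z: "z \<in> K" using K(2) elim by (simp add: z_def)
      have "norm (prox \<mu> (\<Phi>t t) (z - \<mu> *\<^sub>R Bt t z) - prox \<mu> (\<Phi>t t) (z - \<mu> *\<^sub>R B z))
          \<le> norm ((z - \<mu> *\<^sub>R Bt t z) - (z - \<mu> *\<^sub>R B z))"
        using \<Phi>t elim \<open>0 < \<mu>\<close> by (intro prox_nonexpansive) auto
      also have "(z - \<mu> *\<^sub>R Bt t z) - (z - \<mu> *\<^sub>R B z) = - (\<mu> *\<^sub>R (Bt t z - B z))"
        by (simp add: algebra_simps)
      also have "norm \<dots> \<le> \<mu> * S t"
        using S[OF elim z] \<open>0 < \<mu>\<close> by simp
      finally have 1: "norm (prox \<mu> (\<Phi>t t) (z - \<mu> *\<^sub>R Bt t z) - prox \<mu> (\<Phi>t t) (z - \<mu> *\<^sub>R B z)) \<le> \<mu> * S t" .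
      have "norm (prox \<mu> (\<Phi>t t) (z - \<mu> *\<^sub>R B z) - prox \<mu> \<Phi> (z - \<mu> *\<^sub>R B z))
          \<le> \<kappa> t * (norm (z - \<mu> *\<^sub>R B z) + c) powr p"
        using elim by (rule prox_close)
      also have "\<dots> \<le> \<kappa> t * (R + c) powr p"
        using R[OF z] kappa[OF elim] \<open>c > 0\<close> \<open>p > 0\<close> by (intro mult_left_mono powr_mono2) auto
      finally have "norm (prox \<mu> (\<Phi>t t) (z - \<mu> *\<^sub>R Bt t z) - prox \<mu> \<Phi> (z - \<mu> *\<^sub>R B z)) \<le> \<mu> * S t + \<kappa> t * (R + c) powr p"
        using 1 norm_diff_triangle_le by blast
      then have "norm (prox \<mu> (\<Phi>t t) (z - \<mu> *\<^sub>R Bt t z) - prox \<mu> \<Phi> (z - \<mu> *\<^sub>R B z)) / \<epsilon> t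
          \<le> (\<mu> * S t + \<kappa> t * (R + c) powr p) / \<epsilon> t"
        using eps_pos[OF elim] by (intro divide_right_mono) auto
      then show ?case unfolding z_def by (simp add: add_divide_distrib mult.commute)
    qed
  qed
qed

theorem theorem2:
  fixes \<Phi> :: "'a::{real_inner, complete_space} \<Rightarrow> ereal"
    and \<Phi>t :: "real \<Rightarrow> 'a \<Rightarrow> ereal"
    and D :: "'a set"
    and B :: "'a \<Rightarrow> 'a"
    and Bt :: "real \<Rightarrow> 'a \<Rightarrow> 'a"
    and \<beta> \<mu> c\<Phi> p :: real
    and \<epsilon> \<kappa> :: "real \<Rightarrow> real"
    and x0 y :: 'a
    and x :: "real \<Rightarrow> 'a"
  assumes "\<beta> > 0"
    and "proper_convex_lsc \<Phi>"
    and "\<forall>t\<ge>0. proper_convex_lsc (\<Phi>t t)"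
    and "D \<noteq> {}" and "closed D" and "convex D"
    and "closure (effective_domain \<Phi>) \<subseteq> D"
    and "\<forall>t\<ge>0. closure (effective_domain (\<Phi>t t)) \<subseteq> D"
    and "cocoercive_on D \<beta> B"
    and "\<forall>t\<ge>0. cocoercive_on D \<beta> (Bt t)"
    and "y \<in> D"
    and "0 < \<mu>" and "\<mu> < 2 * \<beta>"
    and eps_pos: "\<forall>t\<ge>0. \<epsilon> t > 0"
    and eps_ac: "abs_continuous_on {0..} \<epsilon>"
    and eps_noninc: "antimono_on {0..} \<epsilon>"
    and eps_lim: "(\<epsilon> \<longlongrightarrow> 0) at_top"
    and eps_int: "(\<integral>\<^sup>+ s\<in>{0..}. ennreal (\<epsilon> s) \<partial>lebesgue) = \<infinity>"
    and eps_deriv: "ess_tendsto_at_top (\<lambda>t. deriv \<epsilon> t / (\<epsilon> t)\<^sup>2) 0"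
    and Phi_meas: "\<forall>z. (\<lambda>t. \<Phi>t t z) \<in> borel_measurable (lebesgue_on {0..})"
    and kappa_nonneg: "\<forall>t\<ge>0. \<kappa> t \<ge> 0"
    and "c\<Phi> > 0" and "p > 0"
    and prox_close: "\<forall>t\<ge>0. \<forall>z. norm (prox \<mu> (\<Phi>t t) z - prox \<mu> \<Phi> z) \<le> \<kappa> t * (norm z + c\<Phi>) powr p"
    and kappa_lim: "((\<lambda>t. \<kappa> t / \<epsilon> t) \<longlongrightarrow> 0) at_top"
    and B_close: "\<forall>K. compact K \<and> K \<noteq> {} \<and> K \<subseteq> D \<longrightarrow>
          ((\<lambda>t. 1 / \<epsilon> t * (SUP z\<in>K. norm (Bt t z - B z))) \<longlongrightarrow> 0) at_top"
    and prox_meas: "\<forall>z\<in>D. (\<lambda>t. prox \<mu> (\<Phi>t t) (z - \<mu> *\<^sub>R Bt t z)) \<in> borel_measurable (lebesgue_on {0..})"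
    and "x0 \<in> D"
    and sol: "is_solution D
          (\<lambda>t z. - (z - prox \<mu> (\<Phi>t t) (z - \<mu> *\<^sub>R Bt t z) + \<epsilon> t *\<^sub>R (z - y))) x0 x"
    and "zer_sum D \<Phi> B \<noteq> {}"
  shows "(x \<longlongrightarrow> proj (zer_sum D \<Phi> B) y) at_top"
proof -
  define T where "T z = prox \<mu> \<Phi> (z - \<mu> *\<^sub>R B z)" for z
  define Tt where "Tt t z = prox \<mu> (\<Phi>t t) (z - \<mu> *\<^sub>R Bt t z)" for t z
  have zer: "zer_sum D \<Phi> B = {z \<in> D. T z = z}"
    unfolding T_def by (intro zer_sum_eq_fixed_points assms)
  then have nonempty: "{z \<in> D. T z = z} \<noteq> {}" using \<open>zer_sum D \<Phi> B \<noteq> {}\<close> by simp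
  then obtain q where q: "q \<in> D" "T q = q" by blast
  interpret anchored_nonexpansive D T y
    unfolding T_def by (rule anchored_nonexpansive_forward_backward) (rule assms)+
  have Tt: "anchored_nonexpansive D (Tt t) y" if "t \<ge> 0" for t
    unfolding Tt_def using that assms by (intro anchored_nonexpansive_forward_backward) auto
  define zlim where "zlim = proj (zer_sum D \<Phi> B) y"
  have lim: "(browder_path \<longlongrightarrow> zlim) (at_right 0)" and zlim_D: "zlim \<in> D"
    unfolding zlim_def zer by (rule browder_path_tendsto_proj[OF nonempty])+
  define \<xi> where "\<xi> t = browder_path (\<epsilon> t)" for t
  define K where "K = insert zlim (browder_path ` {0<..\<epsilon> 0})"
  have K: "compact K"
    unfolding K_def zlim_def zer using eps_pos by (intro compact_browder_path nonempty) simp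
  have KD: "K \<subseteq> D" "K \<noteq> {}" using zlim_D browder_path_in by (auto simp: K_def)
  have \<xi>K: "\<xi> t \<in> K" if "t \<ge> 0" for t
    using that eps_pos eps_noninc by (auto simp: K_def \<xi>_def monotone_on_def)
  have "((\<lambda>t. norm (Tt t (\<xi> t) - T (\<xi> t)) / \<epsilon> t) \<longlongrightarrow> 0) at_top"
    unfolding Tt_def T_def
  proof (rule forward_backward_perturbation)
    show "continuous_on K B"
      by (rule continuous_on_subset[OF cocoercive_on_continuous KD(1)]) (rule assms)+
    show "continuous_on K (Bt t)" if "t \<ge> 0" for t
      by (rule continuous_on_subset[OF cocoercive_on_continuous KD(1)]) (use assms(1,10) that in auto)
    show "((\<lambda>t. 1 / \<epsilon> t * (SUP z\<in>K. norm (Bt t z - B z))) \<longlongrightarrow> 0) at_top"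
      using B_close K KD by blast
    fix t :: real assume t: "t \<ge> 0"
    show "proper_convex_lsc (\<Phi>t t)" "\<epsilon> t > 0" "\<kappa> t \<ge> 0"
      using assms(3) eps_pos kappa_nonneg t by simp_all
    show "norm (prox \<mu> (\<Phi>t t) z - prox \<mu> \<Phi> z) \<le> \<kappa> t * (norm z + c\<Phi>) powr p" for z
      using prox_close t by simp
    show "\<xi> t \<in> K" using t by (rule \<xi>K)
  qed (fact K kappa_lim \<open>0 < \<mu>\<close> \<open>c\<Phi> > 0\<close> \<open>p > 0\<close>)+
  then have track: "((\<lambda>t. x t - browder_path (\<epsilon> t)) \<longlongrightarrow> 0) at_top"
    unfolding \<xi>_def
  proof (rule tracks_browder_path[OF q _ eps_ac eps_noninc eps_int eps_deriv, rotated 2])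
    show "is_solution D (\<lambda>t z. - (z - Tt t z + \<epsilon> t *\<^sub>R (z - y))) x0 x"
      unfolding Tt_def by (rule sol)
    show "norm (Tt t z - Tt t w) \<le> norm (z - w)" if "t \<ge> 0" "z \<in> D" "w \<in> D" for t z w
      using Tt[OF that(1)] that(2,3) by (rule anchored_nonexpansive.T_nonexpansive)
  qed (use eps_pos in blast)
  have "filterlim \<epsilon> (at_right 0) at_top"
    unfolding filterlim_at
  proof
    show "\<forall>\<^sub>F t in at_top. \<epsilon> t \<in> {0<..} \<and> \<epsilon> t \<noteq> 0"
      using eventually_ge_at_top[of 0] by eventually_elim (use eps_pos in force)
  qed (rule eps_lim)
  then have "((\<lambda>t. browder_path (\<epsilon> t)) \<longlongrightarrow> zlim) at_top" by (rule filterlim_compose[OF lim])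
  from tendsto_add[OF track this] show ?thesis by (simp add: zlim_def)
qed

end
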